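(* Let $\sigma$ be an irreducible incommensurable normalized multiscale substitution scheme in $\mathbb{R}^d$ with prototiles $T_1,\dots,T_n$ and constants of substitution $\alpha_{hj}^{(k)}$. For every $j=1,\dots,n$ and $0\le a<b\le1$, the number of tiles of type $j$ in $F_t(T_i)$ with scale in $[a,b]$ (equivalently, with volume in $[a^d,b^d]$) grows as $$\varphi_{j,[a,b]}\,e^{dt}+o(e^{dt}),\qquad t\to\infty,$$ where $\varphi_{j,[a,b]}$ does not depend on $i$ and is given by $\varphi_{j,[a,b]}:=\sum_{h=1}^n c_{hj,[a,b]}\,q_h$ with $$c_{hj,[a,b]}:=\frac1d\sum_{k=1}^{k_{hj}}\left(\alpha_{hj}^{(k)}\right)^d\left(\left(\eta_{hj}^{(k)}(a)\right)^{-d}-\left(\mu_{hj}^{(k)}(b)\right)^{-d}\right),$$ $$\eta_{hj}^{(k)}(a):=\max\{a,\alpha_{hj}^{(k)}\},\qquad \mu_{hj}^{(k)}(b):=\max\{b,\alpha_{hj}^{(k)}\},$$ and $q_h$ is the (common) value of the entries in column $h$ of the matrix $Q_\sigma$ defined in the context.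
   Context: Schemes. A tile in $\mathbb{R}^d$ is a bounded Lebesgue measurable set $T$ of positive measure $\mathrm{vol}\,T$ whose boundary has measure zero. A tessellation of $U\subset\mathbb{R}^d$ is a collection of tiles with pairwise disjoint interiors and union $U$; it is called a patch if $U$ is bounded ($U$ is then the support of the patch). A multiscale substitution scheme $\sigma=(\tau_\sigma,\varrho_\sigma)$ consists of a finite list of prototiles $\tau_\sigma=(T_1,\dots,T_n)$ and, for each $i$, a tessellation $\varrho_\sigma(T_i)$ of $T_i$ all of whose tiles are translates of rescaled prototiles; the list of these rescaled prototiles is $\omega_\sigma(T_i)=(\alpha_{ij}^{(k)}T_j:\ j=1,\dots,n,\ k=1,\dots,k_{ij})$. The numbers $\alpha_{ij}^{(k)}\in(0,1)$ are the constants of substitution. A translate of $\alpha T_j$, $\alpha>0$, is a tile of type $j$ and scale $\alpha$. Standing assumptions: $\sigma$ is normalized, i.e. $\mathrm{vol}\,T_i=1$ for all $i$; distinct prototiles are geometrically different ($T_i$ is not a rescaled copy of $T_j$ for $i\ne j$), so the type of a tile is determined by the tile. Substitution semi-flow. For $t\ge 0$, $F_t(T_i)$ is the patch supported on $e^tT_i$ obtained by starting with $e^tT_i$ and repeatedly substituting (according to the rescaled rule $\varrho_\sigma$) every tile of volume $>1$, until all tiles have volume $\le 1$. $\sigma$ is irreducible if for all $i,j$ there is $t>0$ such that $F_t(T_i)$ contains a tile of type $j$. $\sigma$ is incommensurable if there are $i,j$ and $t_1,t_2>0$ with $t_1\notin\mathbb{Q}t_2$ such that $F_{t_1}(T_i)$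 contains a tile of type $i$ and unit volume and $F_{t_2}(T_j)$ contains a tile of type $j$ and unit volume. Matrices. The graph matrix function $M_\sigma:\mathbb{C}\to M_n(\mathbb{C})$ has entries $(M_\sigma(s))_{ij}=\sum_{k=1}^{k_{ij}}(\alpha_{ij}^{(k)})^s$ (zero if $k_{ij}=0$), and $M_\sigma'$ is its entrywise derivative. Put $$Q_\sigma=\frac{\mathrm{adj}(I-M_\sigma(d))}{-\mathrm{tr}\big(\mathrm{adj}(I-M_\sigma(d))\cdot M_\sigma'(d)\big)},$$ where $\mathrm{adj}$ is the adjugate (for $n=1$ the $1\times1$ matrix $(1)$). $Q_\sigma$ is a positive rank $1$ matrix whose columns are multiples of $(1,\dots,1)^T$; $q_h$ denotes the number such that column $h$ of $Q_\sigma$ is $q_h\cdot(1,\dots,1)^T$. *)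

theory Defs
  imports
    "HOL-Analysis.Analysis"
    "HOL-Library.Landau_Symbols"
    "HOL-Library.Multiset"
    "Jordan_Normal_Form.Determinant"
begin

abbreviation vol :: "(real ^ 'd::finite) set \<Rightarrow> real" where
  "vol S \<equiv> measure lebesgue S"

definition tile :: "(real ^ 'd::finite) set \<Rightarrow> bool" where
  "tile T \<longleftrightarrow> bounded T \<and> T \<in> sets lebesgue \<and> vol T > 0 \<and> frontier T \<in> null_sets lebesgue"

definition tessellation :: "(real ^ 'd::finite) set \<Rightarrow> (real ^ 'd) set set \<Rightarrow> bool" where
  "tessellation U P \<longleftrightarrow>
     (\<forall>S\<in>P. tile S) \<and> pairwise (\<lambda>S S'. interior S \<inter> interior S' = {}) P \<and> \<Union>P = U"

definition place :: "real ^ 'd::finite \<Rightarrow> real \<Rightarrow> (real ^ 'd) set \<Rightarrow> (real ^ 'd) set" where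
  "place v \<alpha> S = (\<lambda>x. v + \<alpha> *\<^sub>R x) ` S"

text \<open>Prototiles are indexed by \<open>0, \<dots>, n - 1\<close>; \<open>rule \<sigma> i\<close> is the tessellation
  of the \<open>i\<close>-th prototile and is only meaningful for \<open>i < n\<close>.\<close>

record ('d::finite) scheme =
  prototiles :: "(real ^ 'd) set list"
  rule :: "nat \<Rightarrow> (real ^ 'd) set set"

abbreviation num :: "'d::finite scheme \<Rightarrow> nat" where
  "num \<sigma> \<equiv> length (prototiles \<sigma>)"

abbreviation proto :: "'d::finite scheme \<Rightarrow> nat \<Rightarrow> (real ^ 'd) set" where
  "proto \<sigma> i \<equiv> prototiles \<sigma> ! i"

definition tile_of :: "'d::finite scheme \<Rightarrow> nat \<Rightarrow> real \<Rightarrow> (real ^ 'd) set \<Rightarrow> bool" where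
  "tile_of \<sigma> j \<alpha> S \<longleftrightarrow> \<alpha> > 0 \<and> (\<exists>v. S = place v \<alpha> (proto \<sigma> j))"

definition substitution_scheme :: "'d::finite scheme \<Rightarrow> bool" where
  "substitution_scheme \<sigma> \<longleftrightarrow>
     (\<forall>i<num \<sigma>. tile (proto \<sigma> i)) \<and>
     (\<forall>i<num \<sigma>. finite (rule \<sigma> i) \<and> tessellation (proto \<sigma> i) (rule \<sigma> i) \<and>
        (\<forall>S\<in>rule \<sigma> i. \<exists>j<num \<sigma>. \<exists>\<alpha>\<in>{0<..<1}. tile_of \<sigma> j \<alpha> S))"

definition normalized :: "'d::finite scheme \<Rightarrow> bool" where
  "normalized \<sigma> \<longleftrightarrow> (\<forall>i<num \<sigma>. vol (proto \<sigma> i) = 1)"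

text \<open>Copies are taken up to translation, as needed for a tile to determine its type.\<close>

definition geometrically_different :: "'d::finite scheme \<Rightarrow> bool" where
  "geometrically_different \<sigma> \<longleftrightarrow>
     (\<forall>i<num \<sigma>. \<forall>j<num \<sigma>. i \<noteq> j \<longrightarrow> \<not> (\<exists>\<alpha>. tile_of \<sigma> j \<alpha> (proto \<sigma> i)))"

text \<open>The list \<open>\<alpha>\<^sub>i\<^sub>j\<^sup>(\<^sup>k\<^sup>)\<close>, \<open>k = 1, \<dots>, k\<^sub>i\<^sub>j\<close>, as a multiset: only sums over \<open>k\<close> are
  ever formed. The scale is unique because prototiles are bounded of positive measure.\<close>

definition consts_of :: "'d::finite scheme \<Rightarrow> nat \<Rightarrow> nat \<Rightarrow> real multiset" where
  "consts_of \<sigma> i j =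
     image_mset (\<lambda>S. THE \<alpha>. tile_of \<sigma> j \<alpha> S) (mset_set {S \<in> rule \<sigma> i. \<exists>\<alpha>. tile_of \<sigma> j \<alpha> S})"

text \<open>For a geometrically different scheme, a tile determines its type, scale and translation
  vector, so the set below is the rescaled rule applied to the single tile \<open>S\<close>.\<close>

definition substitute :: "'d::finite scheme \<Rightarrow> (real ^ 'd) set \<Rightarrow> (real ^ 'd) set set" where
  "substitute \<sigma> S =
     {place v \<alpha> U | v \<alpha> j U. \<alpha> > 0 \<and> j < num \<sigma> \<and> S = place v \<alpha> (proto \<sigma> j) \<and> U \<in> rule \<sigma> j}"

definition step :: "'d::finite scheme \<Rightarrow> (real ^ 'd) set set \<Rightarrow> (real ^ 'd) set set" where
  "step \<sigma> P = {S \<in> P. vol S \<le> 1} \<union> (\<Union>S\<in>{S \<in> P. vol S > 1}. substitute \<sigma> S)"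

definition flow :: "'d::finite scheme \<Rightarrow> real \<Rightarrow> nat \<Rightarrow> (real ^ 'd) set set" where
  "flow \<sigma> t i =
     (let P = (\<lambda>m. (step \<sigma> ^^ m) {place 0 (exp t) (proto \<sigma> i)})
      in P (LEAST m. \<forall>S\<in>P m. vol S \<le> 1))"

definition irreducible_scheme :: "'d::finite scheme \<Rightarrow> bool" where
  "irreducible_scheme \<sigma> \<longleftrightarrow>
     (\<forall>i<num \<sigma>. \<forall>j<num \<sigma>. \<exists>t>0. \<exists>S\<in>flow \<sigma> t i. \<exists>\<alpha>. tile_of \<sigma> j \<alpha> S)"

definition incommensurable :: "'d::finite scheme \<Rightarrow> bool" where
  "incommensurable \<sigma> \<longleftrightarrow>
     (\<exists>i<num \<sigma>. \<exists>j<num \<sigma>. \<exists>t\<^sub>1>0. \<exists>t\<^sub>2>0. (\<forall>r\<in>\<rat>. t\<^sub>1 \<noteq> r * t\<^sub>2) \<and>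
        (\<exists>S\<in>flow \<sigma> t\<^sub>1 i. (\<exists>\<alpha>. tile_of \<sigma> i \<alpha> S) \<and> vol S = 1) \<and>
        (\<exists>S\<in>flow \<sigma> t\<^sub>2 j. (\<exists>\<alpha>. tile_of \<sigma> j \<alpha> S) \<and> vol S = 1))"

definition graph_matrix :: "'d::finite scheme \<Rightarrow> complex \<Rightarrow> complex mat" where
  "graph_matrix \<sigma> s =
     mat (num \<sigma>) (num \<sigma>) (\<lambda>(i, j). \<Sum>\<alpha>\<in>#consts_of \<sigma> i j. complex_of_real \<alpha> powr s)"

definition graph_matrix_deriv :: "'d::finite scheme \<Rightarrow> complex \<Rightarrow> complex mat" where
  "graph_matrix_deriv \<sigma> s =
     mat (num \<sigma>) (num \<sigma>) (\<lambda>(i, j). deriv (\<lambda>z. graph_matrix \<sigma> z $$ (i, j)) s)"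

definition mat_trace :: "'a::comm_monoid_add mat \<Rightarrow> 'a" where
  "mat_trace A = sum_list (diag_mat A)"

definition Q_matrix :: "'d::finite scheme \<Rightarrow> complex mat" where
  "Q_matrix \<sigma> =
     (let d = of_nat CARD('d);
          A = adj_mat (1\<^sub>m (num \<sigma>) - graph_matrix \<sigma> d)
      in inverse (- mat_trace (A * graph_matrix_deriv \<sigma> d)) \<cdot>\<^sub>m A)"

definition Q_col :: "'d::finite scheme \<Rightarrow> nat \<Rightarrow> real" where
  "Q_col \<sigma> h = (THE r. \<forall>i<num \<sigma>. Q_matrix \<sigma> $$ (i, h) = complex_of_real r)"

definition c_coeff :: "'d::finite scheme \<Rightarrow> nat \<Rightarrow> nat \<Rightarrow> real \<Rightarrow> real \<Rightarrow> real" where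
  "c_coeff \<sigma> h j a b = 1 / real CARD('d) *
     (\<Sum>\<alpha>\<in>#consts_of \<sigma> h j.
        \<alpha> ^ CARD('d) * ((max a \<alpha>) powi (- int CARD('d)) - (max b \<alpha>) powi (- int CARD('d))))"

definition tile_density :: "'d::finite scheme \<Rightarrow> nat \<Rightarrow> real \<Rightarrow> real \<Rightarrow> real" where
  "tile_density \<sigma> j a b = (\<Sum>h<num \<sigma>. c_coeff \<sigma> h j a b * Q_col \<sigma> h)"

end

theory Submission
  imports Defs "HOL-Real_Asymp.Real_Asymp"
begin

text \<open>
  Read the scheme as a weighted directed graph: the types are the vertices, and every tile of
  scale \<open>\<alpha>\<close> in the rule of the \<open>i\<close>-th prototile is an edge leaving \<open>i\<close>, of length \<open>- ln \<alpha>\<close>. The tiles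
  that occur when \<open>exp t\<close> times the \<open>i\<close>-th prototile is subdivided without end correspond to the
  walks from \<open>i\<close>, a walk of length \<open>l\<close> giving a tile of scale \<open>exp (t - l)\<close>. A tile is left over in the flow
  if its scale is at most 1 and its parent was larger than 1. So a tile of type \<open>j\<close> with scale in
  \<open>[a, b]\<close> is a walk from \<open>i\<close> to some \<open>h\<close>, of length \<open>l < t\<close>, followed by an edge from \<open>h\<close> to \<open>j\<close> of
  scale \<open>\<alpha>\<close> with \<open>a \<le> \<alpha> exp (t - l) \<le> b\<close>. Up to endpoints this says that \<open>t - l\<close> lies between
  \<open>ln (max a \<alpha> / \<alpha>)\<close> and \<open>ln (max b \<alpha> / \<alpha>)\<close>. If the number of walks from \<open>i\<close> to \<open>h\<close> of length at most \<open>t\<close>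
  is asymptotic to \<open>c\<^sub>h exp (d t)\<close>, then the walks in this window contribute
  \<open>c\<^sub>h \<alpha>^d (max a \<alpha>^(-d) - max b \<alpha>^(-d)) exp (d t)\<close>, and the theorem follows once \<open>d c\<^sub>h = q\<^sub>h\<close> is known.

  Convergence (\<open>harmonic_limit\<close>). The walk counts satisfy a renewal equation over the first edge.
  Volume is preserved, that is, \<open>\<alpha>^d\<close> sums to 1 over the edges leaving a vertex; hence after
  division by \<open>exp (d t)\<close> the count at \<open>i\<close> and \<open>t\<close> is a weighted mean of earlier values, plus a
  vanishing source. Let \<open>c\<close> be the upper limit of the maximum over all vertices. When the normalized
  count is close to \<open>c\<close> at some vertex and time, it is also close to \<open>c\<close> at the end of every walk
  leading back from there, because no late value is much larger than \<open>c\<close>. Incommensurability makes the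
  lengths of the walks between any two vertices eventually \<open>\<epsilon>\<close>-dense, and a count that
  increases with time loses at most a factor \<open>exp (- d s)\<close> over a time span \<open>s\<close> when it is
  normalized. So all normalized counts are close to \<open>c\<close> throughout a window longer than every
  edge. Means of numbers close to \<open>c\<close> are close to \<open>c\<close>, hence they stay so forever.

  Identification. Splitting off the last edge shows that \<open>c\<close> is a left invariant vector of the
  stochastic matrix \<open>M(d)\<close> (\<open>walk_limit_left_invariant\<close>). The function \<open>exp (d t)\<close> is the total volume of
  the flow and solves a renewal equation itself; comparing it with Riemann sums of walk counts gives the
  normalization \<open>\<Sum>\<^sub>h c\<^sub>h \<Sum> \<alpha>^d d (- ln \<alpha>) = 1\<close>, the inner sum being over the edges leaving \<open>h\<close>
  (\<open>walk_limit_normalized\<close>). On the other side, the adjugate of \<open>I - M(d)\<close> has rank one: its columns lie in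
  the kernel of \<open>I - M(d)\<close>, so they are constant, and its rows are left invariant, so they are multiples
  of \<open>c\<close> (\<open>adjugate_stochastic\<close>). Dividing by the trace in the definition of \<open>Q\<close> removes the
  unknown factor and leaves \<open>q\<^sub>h = d c\<^sub>h\<close> (\<open>Q_col_eq\<close>).

  Geometry enters through \<open>flow_rec\<close>: the flow of an inflated prototile is the union of the
  translated flows of the tiles in its rule. No tile lies in two of these parts, so tile counts
  satisfy the same renewal equation as walk counts, with a different source.
\<close>

section \<open>The renewal equation on a weighted graph\<close>

lemma tendsto_sum_mset:
  fixes f :: "'a \<Rightarrow> 'b \<Rightarrow> real"
  assumes "\<And>x. x \<in># A \<Longrightarrow> ((\<lambda>t. f x t) \<longlongrightarrow> g x) F"
  shows "((\<lambda>t. \<Sum>x\<in>#A. f x t) \<longlongrightarrow> (\<Sum>x\<in>#A. g x)) F"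
  using assms by (induction A) (auto intro!: tendsto_intros)

lemma sum_sum_mset_commute:
  fixes f :: "'a \<Rightarrow> 'b \<Rightarrow> real"
  shows "(\<Sum>h\<in>H. \<Sum>x\<in>#A. f h x) = (\<Sum>x\<in>#A. \<Sum>h\<in>H. f h x)"
  by (induction A) (simp_all add: sum.distrib)

lemma sum_mset_cmult: "(\<Sum>x\<in>#A. c * f x) = (c :: real) * (\<Sum>x\<in>#A. f x)"
  by (induction A) (simp_all add: distrib_left)

lemma sum_mset_subtractf:
  "(\<Sum>x\<in>#A. (f x :: real) - g x) = (\<Sum>x\<in>#A. f x) - (\<Sum>x\<in>#A. g x)"
  by (induction A) simp_all

lemma sum_mset_nonneg_real: "(\<And>x. x \<in># A \<Longrightarrow> 0 \<le> (f x :: real)) \<Longrightarrow> 0 \<le> (\<Sum>x\<in>#A. f x)"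
  by (induction A) (auto intro!: add_nonneg_nonneg)

lemma exp_mult_ln: "0 < (\<alpha>::real) \<Longrightarrow> exp (real d * (t + ln \<alpha>)) = \<alpha> ^ d * exp (real d * t)"
  by (simp add: distrib_left exp_add exp_of_nat_mult)

text \<open>\<open>E i j\<close> lists the scales of the edges from \<open>i\<close> to \<open>j\<close>. The last assumption says that the tiles of a
  rule fill the prototile: it makes the weights \<open>\<alpha> ^ d\<close> transition probabilities.\<close>
locale substitution_graph =
  fixes n d :: nat and E :: "nat \<Rightarrow> nat \<Rightarrow> real multiset"
  assumes d_pos: "0 < d"
    and scale_bounds: "i < n \<Longrightarrow> j < n \<Longrightarrow> \<alpha> \<in># E i j \<Longrightarrow> 0 < \<alpha> \<and> \<alpha> < 1"
    and volume_preserved: "i < n \<Longrightarrow> (\<Sum>j<n. \<Sum>\<alpha>\<in>#E i j. \<alpha> ^ d) = 1"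
begin

definition edge_sum :: "nat \<Rightarrow> (nat \<Rightarrow> real \<Rightarrow> real) \<Rightarrow> real" where
  "edge_sum i \<phi> = (\<Sum>j<n. \<Sum>\<alpha>\<in>#E i j. \<phi> j \<alpha>)"

lemma edge_sum_mono:
  assumes "\<And>j \<alpha>. j < n \<Longrightarrow> \<alpha> \<in># E i j \<Longrightarrow> \<phi> j \<alpha> \<le> \<psi> j \<alpha>"
  shows "edge_sum i \<phi> \<le> edge_sum i \<psi>"
  unfolding edge_sum_def by (intro sum_mono sum_mset_mono) (use assms in auto)

lemma edge_sum_cong:
  assumes "\<And>j \<alpha>. j < n \<Longrightarrow> \<alpha> \<in># E i j \<Longrightarrow> \<phi> j \<alpha> = \<psi> j \<alpha>"
  shows "edge_sum i \<phi> = edge_sum i \<psi>"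
  by (rule antisym; rule edge_sum_mono) (simp_all add: assms)

lemma edge_sum_add: "edge_sum i (\<lambda>j \<alpha>. \<phi> j \<alpha> + \<psi> j \<alpha>) = edge_sum i \<phi> + edge_sum i \<psi>"
  by (simp add: edge_sum_def sum.distrib sum_mset.distrib)

lemma edge_sum_diff: "edge_sum i (\<lambda>j \<alpha>. \<phi> j \<alpha> - \<psi> j \<alpha>) = edge_sum i \<phi> - edge_sum i \<psi>"
  by (simp add: edge_sum_def sum_subtractf sum_mset_subtractf)

lemma edge_sum_cmult: "edge_sum i (\<lambda>j \<alpha>. c * \<phi> j \<alpha>) = c * edge_sum i \<phi>"
  by (simp only: edge_sum_def sum_distrib_left sum_mset_cmult)

lemma edge_sum_multc: "edge_sum i (\<lambda>j \<alpha>. \<phi> j \<alpha> * c) = edge_sum i \<phi> * c"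
proof -
  have "edge_sum i (\<lambda>j \<alpha>. \<phi> j \<alpha> * c) = edge_sum i (\<lambda>j \<alpha>. c * \<phi> j \<alpha>)"
    by (rule edge_sum_cong) (rule mult.commute)
  also have "\<dots> = edge_sum i \<phi> * c"
    by (subst edge_sum_cmult) (rule mult.commute)
  finally show ?thesis .
qed

lemma edge_sum_zero [simp]: "edge_sum i (\<lambda>j \<alpha>. 0) = 0"
  by (simp add: edge_sum_def)

lemma edge_sum_sum: "edge_sum i (\<lambda>j \<alpha>. \<Sum>m\<in>A. \<phi> m j \<alpha>) = (\<Sum>m\<in>A. edge_sum i (\<phi> m))"
  unfolding edge_sum_def by (subst sum.swap) (simp add: sum_sum_mset_commute)

lemma edge_sum_tendsto:
  assumes "\<And>j \<alpha>. j < n \<Longrightarrow> \<alpha> \<in># E i j \<Longrightarrow> ((\<lambda>t. \<phi> t j \<alpha>) \<longlongrightarrow> \<psi> j \<alpha>) F"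
  shows "((\<lambda>t. edge_sum i (\<phi> t)) \<longlongrightarrow> edge_sum i \<psi>) F"
  unfolding edge_sum_def by (intro tendsto_sum tendsto_sum_mset) (use assms in auto)

lemma edge_sum_volume: "i < n \<Longrightarrow> edge_sum i (\<lambda>j \<alpha>. \<alpha> ^ d) = 1"
  by (simp add: edge_sum_def volume_preserved)

lemma scale_pos: "i < n \<Longrightarrow> j < n \<Longrightarrow> \<alpha> \<in># E i j \<Longrightarrow> 0 < \<alpha>"
  using scale_bounds by auto

lemma edge_length_bounds:
  obtains \<delta> L where "0 < \<delta>" "0 < L"
    "\<And>i j \<alpha>. i < n \<Longrightarrow> j < n \<Longrightarrow> \<alpha> \<in># E i j \<Longrightarrow> ln \<alpha> \<le> - \<delta> \<and> - L \<le> ln \<alpha>"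
proof -
  define A where "A = insert 1 ((\<lambda>\<alpha>. - ln \<alpha>) ` (\<Union>i<n. \<Union>j<n. set_mset (E i j)))"
  have fin: "finite A" and ne: "A \<noteq> {}" by (auto simp: A_def)
  have pos: "x > 0" if "x \<in> A" for x
    using that scale_bounds by (auto simp: A_def ln_less_zero)
  have mem: "- ln \<alpha> \<in> A" if "i < n" "j < n" "\<alpha> \<in># E i j" for i j \<alpha>
    using that by (auto simp: A_def)
  show thesis
  proof
    show "0 < Min A" using fin ne pos by simp
    show "0 < Max A" using fin ne pos by (meson Max_in)
    show "ln \<alpha> \<le> - Min A \<and> - Max A \<le> ln \<alpha>" if "i < n" "j < n" "\<alpha> \<in># E i j" for i j \<alpha>
      using Min_le[OF fin mem[OF that]] Max_ge[OF fin mem[OF that]] by linarith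
  qed
qed

text \<open>The renewal equation with source \<open>w\<close>. Vanishing for negative times makes the solution
  unique, and it forces \<open>w\<close> to vanish there too.\<close>
definition solves :: "(nat \<Rightarrow> real \<Rightarrow> real) \<Rightarrow> (nat \<Rightarrow> real \<Rightarrow> real) \<Rightarrow> bool" where
  "solves w u \<longleftrightarrow> (\<forall>i<n. \<forall>t. (t < 0 \<longrightarrow> u i t = 0) \<and>
     u i t = edge_sum i (\<lambda>j \<alpha>. u j (t + ln \<alpha>)) + w i t)"

lemma solves_0: "solves w u \<Longrightarrow> i < n \<Longrightarrow> t < 0 \<Longrightarrow> u i t = 0"
  and solves_eq: "solves w u \<Longrightarrow> i < n \<Longrightarrow> u i t = edge_sum i (\<lambda>j \<alpha>. u j (t + ln \<alpha>)) + w i t"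
  by (auto simp: solves_def)

text \<open>Every edge moves time backwards by a fixed positive amount, so inequalities propagate
  forward from the past in steps of that size.\<close>
lemma forward_induct:
  assumes past: "\<And>i t. i < n \<Longrightarrow> s \<le> t \<Longrightarrow> t < s' \<Longrightarrow> P i t"
    and forward: "\<And>i t. i < n \<Longrightarrow> s' \<le> t \<Longrightarrow>
       (\<And>j \<alpha>. j < n \<Longrightarrow> \<alpha> \<in># E i j \<Longrightarrow> s \<le> t + ln \<alpha> \<Longrightarrow> P j (t + ln \<alpha>)) \<Longrightarrow> P i t"
    and "i < n" "s \<le> t"
  shows "P i t"
proof -
  obtain \<delta> L where \<delta>: "0 < \<delta>" "\<And>i j \<alpha>. i < n \<Longrightarrow> j < n \<Longrightarrow> \<alpha> \<in># E i j \<Longrightarrow> ln \<alpha> \<le> - \<delta> \<and> - L \<le> ln \<alpha>"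
    using edge_length_bounds by metis
  have "\<forall>i<n. \<forall>t\<ge>s. t < s' + real N * \<delta> \<longrightarrow> P i t" for N
  proof (induction N)
    case 0 then show ?case using past by simp
  next
    case (Suc N)
    show ?case
    proof (intro allI impI)
      fix i t assume *: "i < n" "s \<le> t" "t < s' + real (Suc N) * \<delta>"
      show "P i t"
      proof (cases "t < s'")
        case False
        show ?thesis
        proof (rule forward)
          fix j \<alpha> assume "j < n" "\<alpha> \<in># E i j" "s \<le> t + ln \<alpha>"
          moreover from this have "t + ln \<alpha> < s' + real N * \<delta>"
            using \<delta>(2)[of i j \<alpha>] * by (auto simp: algebra_simps)
          ultimately show "P j (t + ln \<alpha>)" using Suc by blast
        qed (use * False in auto)
      qed (use past * in auto)
    qed
  qed
  moreover obtain N where "(t - s') < real N * \<delta>"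
    using reals_Archimedean3[OF \<delta>(1)] by blast
  then have "t < s' + real N * \<delta>" by linarith
  ultimately show ?thesis using assms(3,4) by blast
qed

text \<open>The comparison principle: a source that is squeezed between combinations of shifted unit
  jumps has its solution squeezed between combinations of shifted walk counts.\<close>
lemma solves_mono:
  assumes u: "solves w u" and v: "solves w' v"
    and w: "\<And>i t. i < n \<Longrightarrow> 0 \<le> t \<Longrightarrow> w i t \<le> w' i t" and "i < n"
  shows "u i t \<le> v i t"
proof (cases "t < 0")
  case True then show ?thesis using u v \<open>i < n\<close> by (simp add: solves_0)
next
  case False
  show ?thesis
  proof (rule forward_induct[of 0 0 "\<lambda>i t. u i t \<le> v i t"])
    fix i t assume *: "i < n" "0 \<le> t" "\<And>j \<alpha>. j < n \<Longrightarrow> \<alpha> \<in># E i j \<Longrightarrow> 0 \<le> t + ln \<alpha> \<Longrightarrow> u j (t + ln \<alpha>) \<le> v j (t + ln \<alpha>)"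
    have "edge_sum i (\<lambda>j \<alpha>. u j (t + ln \<alpha>)) \<le> edge_sum i (\<lambda>j \<alpha>. v j (t + ln \<alpha>))"
    proof (rule edge_sum_mono)
      fix j \<alpha> assume "j < n" "\<alpha> \<in># E i j"
      then show "u j (t + ln \<alpha>) \<le> v j (t + ln \<alpha>)"
        using * u v by (cases "0 \<le> t + ln \<alpha>") (auto simp: solves_0)
    qed
    then show "u i t \<le> v i t"
      using w[OF *(1,2)] by (simp add: solves_eq[OF u *(1), of t] solves_eq[OF v *(1), of t])
  qed (use False \<open>i < n\<close> in auto)
qed

lemma solves_unique:
  "solves w u \<Longrightarrow> solves w v \<Longrightarrow> i < n \<Longrightarrow> u i t = v i t"
  using solves_mono[of w u w v i t] solves_mono[of w v w u i t] by force

lemma solves_zero: "solves (\<lambda>i t. 0) (\<lambda>i t. 0)"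
  by (simp add: solves_def)

lemma solves_add:
  "solves w u \<Longrightarrow> solves w' u' \<Longrightarrow> solves (\<lambda>i t. w i t + w' i t) (\<lambda>i t. u i t + u' i t)"
  unfolding solves_def by (simp add: edge_sum_add)

lemma solves_diff:
  "solves w u \<Longrightarrow> solves w' u' \<Longrightarrow> solves (\<lambda>i t. w i t - w' i t) (\<lambda>i t. u i t - u' i t)"
  unfolding solves_def by (simp add: edge_sum_diff)

lemma solves_cmult:
  "solves w u \<Longrightarrow> solves (\<lambda>i t. c * w i t) (\<lambda>i t. c * u i t)"
  unfolding solves_def by (simp add: edge_sum_cmult distrib_left)

lemma solves_sum:
  "finite A \<Longrightarrow> (\<And>m. m \<in> A \<Longrightarrow> solves (w m) (u m)) \<Longrightarrow> solves (\<lambda>i t. \<Sum>m\<in>A. w m i t) (\<lambda>i t. \<Sum>m\<in>A. u m i t)"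
  by (induction A rule: finite_induct) (auto simp: solves_zero intro!: solves_add)

lemma solves_sum_mset:
  "(\<And>m. m \<in># A \<Longrightarrow> solves (w m) (u m)) \<Longrightarrow> solves (\<lambda>i t. \<Sum>m\<in>#A. w m i t) (\<lambda>i t. \<Sum>m\<in>#A. u m i t)"
  by (induction A) (auto simp: solves_zero intro!: solves_add)

lemma solves_edge_sum:
  assumes "\<And>j \<alpha>. j < n \<Longrightarrow> \<alpha> \<in># E h j \<Longrightarrow> solves (w j \<alpha>) (u j \<alpha>)"
  shows "solves (\<lambda>i t. edge_sum h (\<lambda>j \<alpha>. w j \<alpha> i t)) (\<lambda>i t. edge_sum h (\<lambda>j \<alpha>. u j \<alpha> i t))"
  unfolding edge_sum_def by (intro solves_sum solves_sum_mset) (use assms in auto)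

lemma solves_shift:
  assumes "solves w u" "0 \<le> s"
  shows "solves (\<lambda>i t. w i (t - s)) (\<lambda>i t. u i (t - s))"
  using assms unfolding solves_def by (auto simp: algebra_simps)

text \<open>The unit jump at vertex \<open>h\<close>: shifted copies of these are the building blocks of all sources.\<close>
definition delta :: "nat \<Rightarrow> nat \<Rightarrow> real \<Rightarrow> real" where
  "delta h i t = (if i = h \<and> 0 \<le> t then 1 else 0)"

definition transfer :: "(nat \<Rightarrow> real \<Rightarrow> real) \<Rightarrow> nat \<Rightarrow> real \<Rightarrow> real" where
  "transfer u i t = edge_sum i (\<lambda>j \<alpha>. u j (t + ln \<alpha>))"

lemma transfer_Suc:
  "(transfer ^^ Suc m) u i t = edge_sum i (\<lambda>j \<alpha>. (transfer ^^ m) u j (t + ln \<alpha>))"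
  by (simp only: funpow.simps o_apply, rule transfer_def)

text \<open>The \<open>m\<close>-th summand is the number of walks from \<open>i\<close> to \<open>h\<close> with exactly \<open>m\<close> edges and total
  length at most \<open>t\<close>. Only finitely many summands are nonzero.\<close>
definition walk_count :: "nat \<Rightarrow> nat \<Rightarrow> real \<Rightarrow> real" where
  "walk_count h i t = (\<Sum>m. (transfer ^^ m) (delta h) i t)"

lemma solves_walk_count: "solves (delta h) (walk_count h)"
proof -
  obtain \<delta> L where \<delta>: "0 < \<delta>" "\<And>i j \<alpha>. i < n \<Longrightarrow> j < n \<Longrightarrow> \<alpha> \<in># E i j \<Longrightarrow> ln \<alpha> \<le> - \<delta> \<and> - L \<le> ln \<alpha>"
    using edge_length_bounds by metis
  \<comment> \<open>A walk with \<open>m\<close> edges has length at least \<open>m * \<delta>\<close>.\<close>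
  have early: "(transfer ^^ m) (delta h) i t = 0" if "i < n" "t < real m * \<delta>" for m i t
    using that
  proof (induction m arbitrary: i t)
    case (Suc m)
    have "edge_sum i (\<lambda>j \<alpha>. (transfer ^^ m) (delta h) j (t + ln \<alpha>)) = edge_sum i (\<lambda>j \<alpha>. 0)"
    proof (intro edge_sum_cong Suc.IH)
      fix j \<alpha> assume "j < n" "\<alpha> \<in># E i j"
      then show "t + ln \<alpha> < real m * \<delta>"
        using \<delta>(2)[OF Suc.prems(1), of j \<alpha>] Suc.prems(2) by (simp add: algebra_simps)
    qed
    then show ?case by (simp add: transfer_Suc del: funpow.simps)
  qed (simp add: delta_def)
  have finite_sum: "walk_count h i t = (\<Sum>m<N. (transfer ^^ m) (delta h) i t)"
    if "i < n" "t < real N * \<delta>" for i t N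
    unfolding walk_count_def
  proof (rule suminf_finite)
    fix m assume "m \<notin> {..<N}"
    then have "real N * \<delta> \<le> real m * \<delta>" using \<delta>(1) by simp
    then show "(transfer ^^ m) (delta h) i t = 0" using that by (intro early) auto
  qed simp
  show ?thesis unfolding solves_def
  proof (intro allI impI conjI)
    fix i t assume "i < n"
    then show "t < 0 \<Longrightarrow> walk_count h i t = 0"
      using finite_sum[of i t 0] by simp
    obtain N where N: "t < real N * \<delta>" using reals_Archimedean3[OF \<delta>(1)] by blast
    then have N': "t < real (Suc N) * \<delta>" using \<delta>(1) by (simp add: algebra_simps)
    have "edge_sum i (\<lambda>j \<alpha>. walk_count h j (t + ln \<alpha>))
        = edge_sum i (\<lambda>j \<alpha>. \<Sum>m<N. (transfer ^^ m) (delta h) j (t + ln \<alpha>))"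
    proof (intro edge_sum_cong finite_sum)
      fix j \<alpha> assume "j < n" "\<alpha> \<in># E i j"
      then show "t + ln \<alpha> < real N * \<delta>"
        using \<delta>(1) \<delta>(2)[OF \<open>i < n\<close>, of j \<alpha>] N by linarith
    qed
    also have "\<dots> = (\<Sum>m<N. (transfer ^^ Suc m) (delta h) i t)"
      by (simp add: edge_sum_sum transfer_Suc del: funpow.simps)
    also have "\<dots> + delta h i t = walk_count h i t"
      unfolding finite_sum[OF \<open>i < n\<close> N'] sum.lessThan_Suc_shift by simp
    finally show "walk_count h i t = edge_sum i (\<lambda>j \<alpha>. walk_count h j (t + ln \<alpha>)) + delta h i t"
      by simp
  qed
qed

lemma walk_count_nonneg: "i < n \<Longrightarrow> 0 \<le> walk_count h i t"
  using solves_mono[OF solves_zero solves_walk_count[of h], of i t] by (simp add: delta_def)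

text \<open>Delaying the source can only decrease the solution.\<close>
lemma walk_count_mono:
  assumes "i < n" "s \<le> t" shows "walk_count h i s \<le> walk_count h i t"
  using solves_mono[OF solves_shift[OF solves_walk_count[of h], of "t - s"] solves_walk_count[of h], of i t] assms
  by (simp add: delta_def)

section \<open>Exponential growth of the number of walks\<close>

lemma edge_sum_ge_single:
  assumes "\<And>g \<beta>. g < n \<Longrightarrow> \<beta> \<in># E i g \<Longrightarrow> 0 \<le> \<phi> g \<beta>" and "j < n" "\<alpha> \<in># E i j"
  shows "\<phi> j \<alpha> \<le> edge_sum i \<phi>"
proof -
  obtain B where B: "E i j = add_mset \<alpha> B" using assms(3) by (metis insert_DiffM)
  have "0 \<le> (\<Sum>\<beta>\<in>#B. \<phi> j \<beta>)"
    by (rule sum_mset_nonneg_real) (use assms(1)[OF \<open>j < n\<close>] B in auto)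
  then have "\<phi> j \<alpha> \<le> (\<Sum>\<beta>\<in>#E i j. \<phi> j \<beta>)" by (simp add: B)
  also have "\<dots> \<le> edge_sum i \<phi>"
    unfolding edge_sum_def
    by (rule member_le_sum) (use assms in \<open>auto intro: sum_mset_nonneg_real\<close>)
  finally show ?thesis .
qed

lemma edge_exists:
  assumes "i < n" obtains j \<alpha> where "j < n" "\<alpha> \<in># E i j"
proof -
  have "\<exists>j<n. \<exists>\<alpha>. \<alpha> \<in># E i j"
  proof (rule ccontr)
    assume *: "\<not> ?thesis"
    have "edge_sum i (\<lambda>j \<alpha>. \<alpha> ^ d) = edge_sum i (\<lambda>j \<alpha>. 0)"
      by (rule edge_sum_cong) (use * in blast)
    then show False using edge_sum_volume[OF assms] by simp
  qed
  then show thesis using that by blast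
qed

text \<open>One edge alone would have weight \<open>\<alpha> ^ d < 1\<close> and could not carry the whole volume.\<close>
lemma two_edges:
  assumes "i < n" shows "2 \<le> edge_sum i (\<lambda>j \<alpha>. 1)"
proof -
  obtain j \<alpha> where ja: "j < n" "\<alpha> \<in># E i j" using edge_exists[OF assms] .
  have small: "\<beta> ^ d < 1" if "g < n" "\<beta> \<in># E i g" for g \<beta>
    using scale_bounds[OF assms that] d_pos by (simp add: power_less_one_iff)
  have "0 < 1 - \<alpha> ^ d" using small[OF ja] by simp
  also have "\<dots> \<le> edge_sum i (\<lambda>j \<alpha>. 1 - \<alpha> ^ d)"
    by (rule edge_sum_ge_single[of i "\<lambda>j \<alpha>. 1 - \<alpha> ^ d", OF _ ja]) (use small in \<open>simp add: less_imp_le\<close>)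
  also have "\<dots> = edge_sum i (\<lambda>j \<alpha>. 1) - 1"
    by (simp add: edge_sum_diff edge_sum_volume[OF assms])
  finally have gt: "1 < edge_sum i (\<lambda>j \<alpha>. 1)" by simp
  define N where "N = (\<Sum>j<n. size (E i j))"
  have N: "edge_sum i (\<lambda>j \<alpha>. 1) = real N"
    by (simp add: edge_sum_def N_def)
  have "1 < N" using gt unfolding N by simp
  then show ?thesis unfolding N by simp
qed

text \<open>For large \<open>C\<close> the function \<open>C * exp (d * t) - 1\<close> is a supersolution: taking the edge sum reproduces
  \<open>C * exp (d * t)\<close>, whereas the constant is counted at least twice, which pays for the source.\<close>
lemma walk_count_bound:
  obtains C where "\<And>i t. i < n \<Longrightarrow> walk_count h i t \<le> C * exp (real d * t)"
proof -
  obtain \<delta> L where L: "0 < L" "\<And>i j \<alpha>. i < n \<Longrightarrow> j < n \<Longrightarrow> \<alpha> \<in># E i j \<Longrightarrow> ln \<alpha> \<le> - \<delta> \<and> - L \<le> ln \<alpha>"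
    using edge_length_bounds by metis
  \<comment> \<open>Makes the supersolution nonnegative on \<open>[- L, 0]\<close>, as far back as an edge can reach
    from time 0.\<close>
  define C where "C = exp (real d * L)"
  have late: "walk_count h i t \<le> C * exp (real d * t) - 1" if "i < n" "- L \<le> t" for i t
    using that
  proof (rule forward_induct[of "- L" 0 "\<lambda>i t. walk_count h i t \<le> C * exp (real d * t) - 1", rotated 2])
    fix i t assume "i < n" "- L \<le> t" "t < 0"
    then have "0 \<le> real d * (L + t)" by simp
    then have "1 \<le> exp (real d * (L + t))" by simp
    then show "walk_count h i t \<le> C * exp (real d * t) - 1"
      using solves_0[OF solves_walk_count \<open>i < n\<close> \<open>t < 0\<close>, of h]
      by (simp add: C_def distrib_left exp_add)
  next
    fix i t assume *: "i < n" "0 \<le> t" and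
      IH: "\<And>j \<alpha>. j < n \<Longrightarrow> \<alpha> \<in># E i j \<Longrightarrow> - L \<le> t + ln \<alpha> \<Longrightarrow>
         walk_count h j (t + ln \<alpha>) \<le> C * exp (real d * (t + ln \<alpha>)) - 1"
    have "walk_count h i t \<le> edge_sum i (\<lambda>j \<alpha>. walk_count h j (t + ln \<alpha>)) + 1"
      by (subst solves_eq[OF solves_walk_count *(1)]) (simp add: delta_def)
    also have "edge_sum i (\<lambda>j \<alpha>. walk_count h j (t + ln \<alpha>))
        \<le> edge_sum i (\<lambda>j \<alpha>. \<alpha> ^ d * (C * exp (real d * t)) - 1)"
    proof (rule edge_sum_mono)
      fix j \<alpha> assume ja: "j < n" "\<alpha> \<in># E i j"
      then have "- L \<le> t + ln \<alpha>" using L(2)[OF *(1) ja] *(2) by linarith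
      from IH[OF ja this] show "walk_count h j (t + ln \<alpha>) \<le> \<alpha> ^ d * (C * exp (real d * t)) - 1"
        using scale_pos[OF *(1) ja] by (simp add: exp_mult_ln mult_ac)
    qed
    also have "\<dots> = C * exp (real d * t) - edge_sum i (\<lambda>j \<alpha>. 1)"
      by (simp add: edge_sum_diff edge_sum_multc edge_sum_volume[OF *(1)])
    finally show "walk_count h i t \<le> C * exp (real d * t) - 1"
      using two_edges[OF *(1)] by linarith
  qed
  have "walk_count h i t \<le> C * exp (real d * t)" if "i < n" for i t
  proof (cases "t < 0")
    case True
    then show ?thesis using solves_0[OF solves_walk_count that True, of h] by (simp add: C_def)
  next
    case False
    then show ?thesis using late[OF that, of t] L(1) by simp
  qed
  then show thesis using that by blast
qed

section \<open>Lengths of walks are eventually dense\<close>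

inductive walk :: "nat \<Rightarrow> nat \<Rightarrow> real \<Rightarrow> bool" where
  walk_refl: "i < n \<Longrightarrow> walk i i 0"
| walk_edge: "i < n \<Longrightarrow> j < n \<Longrightarrow> \<alpha> \<in># E i j \<Longrightarrow> walk j k l \<Longrightarrow> walk i k (l - ln \<alpha>)"

lemma walk_trans: "walk i j l \<Longrightarrow> walk j k l' \<Longrightarrow> walk i k (l + l')"
proof (induction rule: walk.induct)
  case (walk_edge i j \<alpha> k l)
  then show ?case using walk.walk_edge[of i j \<alpha> _ "l + l'"] by (simp add: algebra_simps)
qed simp

lemma walk_loop_iterate: "walk i i l \<Longrightarrow> i < n \<Longrightarrow> walk i i (real m * l)"
proof (induction m)
  case (Suc m)
  then show ?case using walk_trans[of i i "real m * l" i l] by (simp add: algebra_simps)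
qed (simp add: walk_refl)

definition dense_walk_lengths :: bool where
  "dense_walk_lengths \<longleftrightarrow> (\<forall>\<epsilon>>0. \<exists>X. \<forall>x\<ge>X. \<forall>i<n. \<forall>j<n. \<exists>l. walk i j l \<and> x \<le> l \<and> l \<le> x + \<epsilon>)"

end

text \<open>By Dirichlet's theorem and irrationality, two elements of the semigroup generated by \<open>t\<^sub>1\<close> and
  \<open>t\<^sub>2\<close> differ by some positive \<open>\<delta> < \<epsilon>\<close>. If they are \<open>y\<close> and \<open>y + \<delta>\<close>, then \<open>k\<close> summands from this pair realise every \<open>k * y + l * \<delta>\<close>
  with \<open>l \<le> k\<close>, and for large \<open>k\<close> these numbers reach up to \<open>(k + 1) * y\<close>.\<close>
lemma two_generators_dense:
  fixes t\<^sub>1 t\<^sub>2 :: real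
  assumes pos: "0 < t\<^sub>1" "0 < t\<^sub>2" and irr: "t\<^sub>1 / t\<^sub>2 \<notin> \<rat>" and "0 < \<epsilon>"
  obtains X where "\<And>x. X \<le> x \<Longrightarrow> \<exists>m k :: nat. x \<le> real m * t\<^sub>1 + real k * t\<^sub>2 \<and> real m * t\<^sub>1 + real k * t\<^sub>2 \<le> x + \<epsilon>"
proof -
  define S where "S = {real m * t\<^sub>1 + real k * t\<^sub>2 | m k :: nat. True}"
  have S_add: "x + y \<in> S" if xy: "x \<in> S" "y \<in> S" for x y
  proof -
    from xy obtain m k m' k' where "x = real m * t\<^sub>1 + real k * t\<^sub>2" "y = real m' * t\<^sub>1 + real k' * t\<^sub>2"
      unfolding S_def by blast
    then have "x + y = real (m + m') * t\<^sub>1 + real (k + k') * t\<^sub>2" by (simp add: algebra_simps)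
    then show ?thesis unfolding S_def by blast
  qed
  have S_mult: "real m * x \<in> S" if "x \<in> S" for m x
  proof (induction m)
    case 0
    have "0 = real 0 * t\<^sub>1 + real 0 * t\<^sub>2" by simp
    then have "0 \<in> S" unfolding S_def by blast
    then show ?case by simp
  next
    case (Suc m)
    then show ?case using S_add[OF \<open>x \<in> S\<close> Suc] by (simp add: algebra_simps)
  qed
  obtain N :: nat where N: "t\<^sub>2 / \<epsilon> < real N" using reals_Archimedean2 by blast
  then have "0 < real N" using pos \<open>0 < \<epsilon>\<close> by (meson divide_pos_pos less_trans)
  then have N0: "N > 0" by simp
  obtain h k where hk: "0 < k" "\<bar>of_int k * (t\<^sub>1 / t\<^sub>2) - of_int h\<bar> < 1 / N"
    using Dirichlet_approx[OF N0, of "t\<^sub>1 / t\<^sub>2"] by metis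
  have "h \<ge> 0"
  proof (rule ccontr)
    assume "\<not> h \<ge> 0"
    then have "of_int h \<le> (-1 :: real)" by linarith
    moreover have "0 < of_int k * (t\<^sub>1 / t\<^sub>2)" using hk(1) pos by simp
    moreover have "1 / real N \<le> 1" using N0 by simp
    ultimately show False using hk(2) by linarith
  qed
  define a where "a = of_int k * t\<^sub>1"
  define b where "b = of_int h * t\<^sub>2"
  have "a = real (nat k) * t\<^sub>1 + real 0 * t\<^sub>2" "b = real 0 * t\<^sub>1 + real (nat h) * t\<^sub>2"
    using hk(1) \<open>h \<ge> 0\<close> by (simp_all add: a_def b_def)
  then have ab: "a \<in> S" "b \<in> S" unfolding S_def by blast+
  have "\<bar>a - b\<bar> = \<bar>of_int k * (t\<^sub>1 / t\<^sub>2) - of_int h\<bar> * t\<^sub>2"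
  proof -
    have "a - b = (of_int k * (t\<^sub>1 / t\<^sub>2) - of_int h) * t\<^sub>2"
      using pos by (simp add: a_def b_def field_simps)
    then show ?thesis using pos by (simp add: abs_mult)
  qed
  also have "\<dots> < 1 / N * t\<^sub>2" using hk(2) pos by (intro mult_strict_right_mono) auto
  also have "\<dots> < \<epsilon>" using N \<open>0 < \<epsilon>\<close> N0 by (simp add: field_simps)
  finally have close: "\<bar>a - b\<bar> < \<epsilon>" .
  have "a \<noteq> b"
  proof
    assume "a = b"
    then have "t\<^sub>1 / t\<^sub>2 = of_int h / of_int k" using hk(1) pos by (simp add: a_def b_def field_simps)
    then show False using irr by simp
  qed
  have "t\<^sub>1 = real 1 * t\<^sub>1 + real 0 * t\<^sub>2" by simp
  then have t1: "t\<^sub>1 \<in> S" unfolding S_def by blast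
  \<comment> \<open>The shift by \<open>t\<^sub>1\<close> ensures \<open>y > 0\<close>: the smaller of \<open>a\<close> and \<open>b\<close> may be 0.\<close>
  define y where "y = min a b + t\<^sub>1"
  define \<delta> where "\<delta> = \<bar>a - b\<bar>"
  have y: "0 < y" "y \<in> S" "y + \<delta> \<in> S" and \<delta>: "0 < \<delta>" "\<delta> < \<epsilon>"
  proof -
    have "0 \<le> a" "0 \<le> b" using hk(1) \<open>h \<ge> 0\<close> pos by (simp_all add: a_def b_def)
    then show "0 < y" using pos by (simp add: y_def)
    show "y \<in> S" using S_add[OF ab(1) t1] S_add[OF ab(2) t1] by (simp add: y_def min_def)
    have "y + \<delta> = max a b + t\<^sub>1" by (simp add: y_def \<delta>_def)
    then show "y + \<delta> \<in> S" using S_add[OF ab(1) t1] S_add[OF ab(2) t1] by (simp add: max_def)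
  qed (use close \<open>a \<noteq> b\<close> in \<open>auto simp: \<delta>_def\<close>)
  show thesis
  proof
    fix x assume x: "y * (of_int \<lceil>y / \<delta>\<rceil>) \<le> x"
    have "0 \<le> y / \<delta>" using y \<delta> by simp
    then have "0 \<le> y * (of_int \<lceil>y / \<delta>\<rceil>)" using y(1) by (intro mult_nonneg_nonneg) linarith+
    then have x0: "0 \<le> x" using x by linarith
    define k where "k = nat \<lfloor>x / y\<rfloor>"
    define l where "l = nat \<lceil>(x - real k * y) / \<delta>\<rceil>"
    have k: "real k = of_int \<lfloor>x / y\<rfloor>" unfolding k_def using x0 y(1) by simp
    have "real k \<le> x / y" "x / y < real k + 1" unfolding k by linarith+
    then have kx: "real k * y \<le> x" "x < real k * y + y" using y(1) by (simp_all add: field_simps)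
    then have "0 \<le> (x - real k * y) / \<delta>" using \<delta> by simp
    then have l: "real l = of_int \<lceil>(x - real k * y) / \<delta>\<rceil>" unfolding l_def by simp
    have "(x - real k * y) / \<delta> \<le> real l" "real l < (x - real k * y) / \<delta> + 1" unfolding l by linarith+
    then have lx: "x - real k * y \<le> real l * \<delta>" "real l * \<delta> \<le> x - real k * y + \<delta>"
      using \<delta>(1) by (simp_all add: field_simps)
    have "\<lceil>(x - real k * y) / \<delta>\<rceil> \<le> \<lceil>y / \<delta>\<rceil>"
      using kx \<delta>(1) by (intro ceiling_mono divide_right_mono) auto
    also have "\<dots> \<le> \<lfloor>x / y\<rfloor>"
      using x y(1) by (simp add: le_floor_iff field_simps)
    finally have "real l \<le> real k" unfolding l k by simp
    then have "l \<le> k" by simp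
    then have "real k * y + real l * \<delta> = real (k - l) * y + real l * (y + \<delta>)"
      by (simp add: of_nat_diff algebra_simps)
    then have "real k * y + real l * \<delta> \<in> S"
      using S_add S_mult y by simp
    then obtain m m' :: nat where "real k * y + real l * \<delta> = real m * t\<^sub>1 + real m' * t\<^sub>2"
      unfolding S_def by blast
    moreover have "x \<le> real k * y + real l * \<delta>" "real k * y + real l * \<delta> \<le> x + \<epsilon>"
      using lx \<delta>(2) by linarith+
    ultimately show "\<exists>m k :: nat. x \<le> real m * t\<^sub>1 + real k * t\<^sub>2 \<and> real m * t\<^sub>1 + real k * t\<^sub>2 \<le> x + \<epsilon>"
      by metis
  qed
qed

context substitution_graph
begin

text \<open>Route every walk through both loops and let it run around each of them often enough.\<close>
lemma dense_walk_lengths_if_incommensurable: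
  assumes conn: "\<And>i j. i < n \<Longrightarrow> j < n \<Longrightarrow> \<exists>l. walk i j l"
    and loops: "p < n" "q < n" "walk p p t\<^sub>1" "walk q q t\<^sub>2" "0 < t\<^sub>1" "0 < t\<^sub>2" "t\<^sub>1 / t\<^sub>2 \<notin> \<rat>"
  shows dense_walk_lengths
  unfolding dense_walk_lengths_def
proof (intro allI impI)
  fix \<epsilon> :: real assume "0 < \<epsilon>"
  obtain X where X: "\<And>x. X \<le> x \<Longrightarrow> \<exists>m k :: nat. x \<le> real m * t\<^sub>1 + real k * t\<^sub>2 \<and> real m * t\<^sub>1 + real k * t\<^sub>2 \<le> x + \<epsilon>"
    using two_generators_dense[OF loops(5-7) \<open>0 < \<epsilon>\<close>] by blast
  have "\<forall>i j. \<exists>l. i < n \<longrightarrow> j < n \<longrightarrow> walk i j l" using conn by blast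
  then obtain f where f: "\<And>i j. i < n \<Longrightarrow> j < n \<Longrightarrow> walk i j (f i j)" by metis
  define base where "base i j = f i p + f p q + f q j" for i j
  define B where "B = Max (insert 0 ((\<lambda>(i,j). base i j) ` ({..<n} \<times> {..<n})))"
  have B: "base i j \<le> B" if "i < n" "j < n" for i j
    unfolding B_def using that by (intro Max_ge) auto
  show "\<exists>X. \<forall>x\<ge>X. \<forall>i<n. \<forall>j<n. \<exists>l. walk i j l \<and> x \<le> l \<and> l \<le> x + \<epsilon>"
  proof (rule exI[of _ "X + B"], intro allI impI)
    fix x i j assume *: "X + B \<le> x" "i < n" "j < n"
    then have "X \<le> x - base i j" using B[OF *(2,3)] by linarith
    then obtain m k where mk: "x - base i j \<le> real m * t\<^sub>1 + real k * t\<^sub>2" "real m * t\<^sub>1 + real k * t\<^sub>2 \<le> x - base i j + \<epsilon>"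
      using X by blast
    have "walk i j (f i p + real m * t\<^sub>1 + f p q + real k * t\<^sub>2 + f q j)"
      by (intro walk_trans[OF walk_trans[OF walk_trans[OF walk_trans[OF
            f[OF *(2) loops(1)] walk_loop_iterate[OF loops(3,1)]] f[OF loops(1,2)]]
            walk_loop_iterate[OF loops(4,2)]] f[OF loops(2) *(3)]])
    then show "\<exists>l. walk i j l \<and> x \<le> l \<and> l \<le> x + \<epsilon>"
      using mk by (intro exI[of _ "f i p + real m * t\<^sub>1 + f p q + real k * t\<^sub>2 + f q j"]) (simp add: base_def)
  qed
qed

section \<open>Convergence of the normalized walk counts\<close>

text \<open>An upper limit that is approached at some vertex propagates backwards along all walks; density of
  the walk lengths and one-sided regularity spread it over a whole window of time; the
  minimum principle then carries it forward to all later times.\<close>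
lemma harmonic_limit:
  assumes dense: dense_walk_lengths
    and nonneg: "\<And>i x. i < n \<Longrightarrow> 0 \<le> k i x"
    and bound: "\<And>i x. i < n \<Longrightarrow> k i x \<le> C"
    and harmonic: "\<And>i x. i < n \<Longrightarrow> k i x = edge_sum i (\<lambda>j \<alpha>. \<alpha> ^ d * k j (x + ln \<alpha>)) + s i x"
    and s_nonneg: "\<And>i x. i < n \<Longrightarrow> 0 \<le> s i x"
    and s_lim: "\<And>i. i < n \<Longrightarrow> (s i \<longlongrightarrow> 0) at_top"
    and regular: "\<And>i x y. i < n \<Longrightarrow> 0 \<le> y \<Longrightarrow> exp (- real d * y) * k i x \<le> k i (x + y)"
  shows "\<exists>c. \<forall>i<n. (k i \<longlongrightarrow> c) at_top"
proof (cases "n = 0")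
  case False
  then have n: "0 < n" by simp
  obtain \<delta> L where L: "0 < L" "\<And>i j \<alpha>. i < n \<Longrightarrow> j < n \<Longrightarrow> \<alpha> \<in># E i j \<Longrightarrow> ln \<alpha> \<le> - \<delta> \<and> - L \<le> ln \<alpha>"
    using edge_length_bounds by metis
  \<comment> \<open>\<open>c\<close> is the upper limit of the maximum of all \<open>k i\<close>.\<close>
  define Y where "Y = {y. \<forall>\<^sub>F x in at_top. \<forall>i<n. k i x \<le> y}"
  define c where "c = Inf Y"
  have "C \<in> Y" by (simp add: Y_def bound)
  have "0 \<le> y" if "y \<in> Y" for y
  proof -
    from that have "\<forall>\<^sub>F x in at_top. \<forall>i<n. k i x \<le> y" by (simp add: Y_def)
    from eventually_happens'[OF trivial_limit_at_top_linorder this]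
    obtain x where "\<forall>i<n. k i x \<le> y" by blast
    then show ?thesis using nonneg[OF n, of x] n by force
  qed
  then have bdd: "bdd_below Y" by (auto simp: bdd_below_def)
  have above: "\<forall>\<^sub>F x in at_top. \<forall>i<n. k i x \<le> c + \<eta>" if "0 < \<eta>" for \<eta>
  proof -
    have "Inf Y < c + \<eta>" using that by (simp add: c_def)
    then obtain y where y: "y \<in> Y" "y < c + \<eta>"
      using \<open>C \<in> Y\<close> bdd cInf_less_iff[of Y "c + \<eta>"] by blast
    then have "\<forall>\<^sub>F x in at_top. \<forall>i<n. k i x \<le> y" by (simp add: Y_def)
    then show ?thesis by eventually_elim (use y(2) in force)
  qed
  have frequently_near: "\<exists>x\<ge>X. \<exists>i<n. c - \<eta> < k i x" if "0 < \<eta>" for \<eta> X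
  proof (rule ccontr)
    assume "\<not> ?thesis"
    then have "\<forall>x\<ge>X. \<forall>i<n. k i x \<le> c - \<eta>" by force
    then have "c - \<eta> \<in> Y" unfolding Y_def by (auto simp: eventually_at_top_linorder)
    then have "c \<le> c - \<eta>" unfolding c_def using bdd by (intro cInf_lower)
    then show False using that by simp
  qed
  \<comment> \<open>A single parameter \<open>\<theta>\<close> expresses both "close to \<open>c\<close>" and "late", so that finitely many such
    statements can be combined by intersecting neighbourhoods of 0.\<close>
  have backwards: "\<forall>\<eta>>0. \<forall>\<^sub>F \<theta> in at_right 0. \<forall>x\<ge>inverse \<theta>. c - \<theta> < k i x \<longrightarrow> c - \<eta> < k j (x - l)"
    if "walk i j l" for i j l
    using that
  proof induction
    case (walk_refl i)
    show ?case
    proof (intro allI impI)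
      fix \<eta> :: real assume "0 < \<eta>"
      then have "\<forall>\<^sub>F \<theta> in at_right 0. \<theta> < \<eta>"
        by (rule order_tendstoD(2)[OF tendsto_ident_at])
      then show "\<forall>\<^sub>F \<theta> in at_right 0. \<forall>x\<ge>inverse \<theta>. c - \<theta> < k i x \<longrightarrow> c - \<eta> < k i (x - 0)"
        by eventually_elim auto
    qed
  next
    case (walk_edge i j \<alpha> h l)
    show ?case
    proof (intro allI impI)
      fix \<eta> :: real assume "0 < \<eta>"
      have "\<forall>\<^sub>F \<theta> in at_right 0. 0 < \<theta> \<and> (\<forall>x\<ge>inverse \<theta>. c - \<theta> < k j x \<longrightarrow> c - \<eta> < k h (x - l))"
        using walk_edge.IH \<open>0 < \<eta>\<close> by (intro eventually_conj eventually_at_right_less) blast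
      then obtain \<theta>\<^sub>1 where \<theta>\<^sub>1: "0 < \<theta>\<^sub>1" "\<And>x. inverse \<theta>\<^sub>1 \<le> x \<Longrightarrow> c - \<theta>\<^sub>1 < k j x \<Longrightarrow> c - \<eta> < k h (x - l)"
        using eventually_happens'[OF trivial_limit_at_right_real] by blast
      have "0 < \<alpha>" using scale_pos walk_edge.hyps by blast
      \<comment> \<open>If \<open>k j\<close> fell short of \<open>c\<close> by \<open>\<theta>\<^sub>1\<close>, then \<open>k i\<close> would lose \<open>\<alpha> ^ d * \<theta>\<^sub>1\<close>. The loss must exceed three errors: the
        bound on the other edges, the source, and the distance of \<open>k i x\<close> from \<open>c\<close>.\<close>
      define \<eta>' where "\<eta>' = \<theta>\<^sub>1 * \<alpha> ^ d / 3"
      have "0 < \<eta>'" using \<theta>\<^sub>1(1) \<open>0 < \<alpha>\<close> by (simp add: \<eta>'_def)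
      have "\<forall>\<^sub>F x in at_top. (\<forall>i<n. k i x \<le> c + \<eta>') \<and> s i x < \<eta>'"
        using above[OF \<open>0 < \<eta>'\<close>] order_tendstoD(2)[OF s_lim[OF \<open>i < n\<close>] \<open>0 < \<eta>'\<close>]
        by (rule eventually_conj)
      then obtain X where X: "\<And>x i. X \<le> x \<Longrightarrow> i < n \<Longrightarrow> k i x \<le> c + \<eta>'" "\<And>x. X \<le> x \<Longrightarrow> s i x < \<eta>'"
        unfolding eventually_at_top_linorder by blast
      have "\<forall>\<^sub>F \<theta> in at_right 0. \<theta> < \<eta>'"
        using \<open>0 < \<eta>'\<close> by (rule order_tendstoD(2)[OF tendsto_ident_at])
      moreover have "\<forall>\<^sub>F \<theta> in at_right 0. max X (inverse \<theta>\<^sub>1) + L \<le> inverse \<theta>"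
        using filterlim_inverse_at_top_right by (simp add: filterlim_at_top)
      ultimately show "\<forall>\<^sub>F \<theta> in at_right 0. \<forall>x\<ge>inverse \<theta>. c - \<theta> < k i x \<longrightarrow> c - \<eta> < k h (x - (l - ln \<alpha>))"
      proof eventually_elim
        case (elim \<theta>)
        show ?case
        proof (intro allI impI)
          fix x assume x: "inverse \<theta> \<le> x" "c - \<theta> < k i x"
          have late: "max X (inverse \<theta>\<^sub>1) \<le> x + ln \<beta>" if "g < n" "\<beta> \<in># E i g" for g \<beta>
            using elim(2) x(1) L(2)[OF \<open>i < n\<close> that] by linarith
          have "\<alpha> ^ d * (c + \<eta>' - k j (x + ln \<alpha>)) \<le> edge_sum i (\<lambda>g \<beta>. \<beta> ^ d * (c + \<eta>' - k g (x + ln \<beta>)))"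
          proof (rule edge_sum_ge_single[of i "\<lambda>g \<beta>. \<beta> ^ d * (c + \<eta>' - k g (x + ln \<beta>))"])
            fix g \<beta> assume g: "g < n" "\<beta> \<in># E i g"
            then show "0 \<le> \<beta> ^ d * (c + \<eta>' - k g (x + ln \<beta>))"
              using X(1)[of "x + ln \<beta>" g] late[OF g] scale_pos[OF \<open>i < n\<close> g] by simp
          qed fact+
          also have "\<dots> = (c + \<eta>') - (k i x - s i x)"
            using harmonic[OF \<open>i < n\<close>, of x]
            by (simp add: right_diff_distrib edge_sum_diff edge_sum_multc edge_sum_volume[OF \<open>i < n\<close>])
          also have "\<dots> < 3 * \<eta>'"
            using x(2) elim(1) X(2)[of x] elim(2) x(1) L(1) by linarith
          also have "\<dots> = \<alpha> ^ d * \<theta>\<^sub>1" by (simp add: \<eta>'_def)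
          finally have "c + \<eta>' - k j (x + ln \<alpha>) < \<theta>\<^sub>1" using \<open>0 < \<alpha>\<close> by simp
          then have "c - \<theta>\<^sub>1 < k j (x + ln \<alpha>)" using \<open>0 < \<eta>'\<close> by linarith
          with \<theta>\<^sub>1(2)[of "x + ln \<alpha>"] late[OF \<open>j < n\<close> \<open>\<alpha> \<in># E i j\<close>]
          show "c - \<eta> < k h (x - (l - ln \<alpha>))" by (simp add: algebra_simps)
        qed
      qed
    qed
  qed
  have below: "\<forall>\<^sub>F x in at_top. \<forall>i<n. exp (- real d * (2 * \<epsilon>)) * (c - \<epsilon>) \<le> k i x" if \<epsilon>: "0 < \<epsilon>" for \<epsilon>
  proof -
    let ?V = "exp (- real d * (2 * \<epsilon>)) * (c - \<epsilon>)"
    obtain X where X: "\<And>x i j. X \<le> x \<Longrightarrow> i < n \<Longrightarrow> j < n \<Longrightarrow> \<exists>l. walk i j l \<and> x \<le> l \<and> l \<le> x + \<epsilon>"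
      using dense \<epsilon> unfolding dense_walk_lengths_def by blast
    obtain M :: nat where M: "L < real M * \<epsilon>" using reals_Archimedean3[OF \<epsilon>] by blast
    \<comment> \<open>One walk for each pair of vertices and each point of an \<open>\<epsilon>\<close>-grid over a window that is longer
      than every edge.\<close>
    have "\<forall>i j m. \<exists>l. i < n \<longrightarrow> j < n \<longrightarrow> walk i j l \<and> X + real m * \<epsilon> \<le> l \<and> l \<le> X + real m * \<epsilon> + \<epsilon>"
      using X \<epsilon> by simp
    then obtain f where f: "\<And>i j m. i < n \<Longrightarrow> j < n \<Longrightarrow> walk i j (f i j m)"
      "\<And>i j m. i < n \<Longrightarrow> j < n \<Longrightarrow> X + real m * \<epsilon> \<le> f i j m"
      "\<And>i j m. i < n \<Longrightarrow> j < n \<Longrightarrow> f i j m \<le> X + real m * \<epsilon> + \<epsilon>"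
      by metis
    have "\<forall>\<^sub>F \<theta> in at_right 0. \<forall>i\<in>{..<n}. \<forall>j\<in>{..<n}. \<forall>m\<in>{..M}.
            \<forall>x\<ge>inverse \<theta>. c - \<theta> < k i x \<longrightarrow> c - \<epsilon> < k j (x - f i j m)"
      by (intro eventually_ball_finite finite_lessThan finite_atMost ballI)
         (use backwards[OF f(1)] \<epsilon> in simp)
    then have ev: "\<forall>\<^sub>F \<theta> in at_right 0. 0 < \<theta> \<and> (\<forall>i\<in>{..<n}. \<forall>j\<in>{..<n}. \<forall>m\<in>{..M}.
            \<forall>x\<ge>inverse \<theta>. c - \<theta> < k i x \<longrightarrow> c - \<epsilon> < k j (x - f i j m))"
      by (intro eventually_conj eventually_at_right_less)
    from eventually_happens'[OF trivial_limit_at_right_real ev]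
    obtain \<theta> where \<theta>: "0 < \<theta>" "\<And>i j m x. i < n \<Longrightarrow> j < n \<Longrightarrow> m \<le> M \<Longrightarrow> inverse \<theta> \<le> x \<Longrightarrow> c - \<theta> < k i x \<Longrightarrow> c - \<epsilon> < k j (x - f i j m)"
      by (metis lessThan_iff atMost_iff)
    obtain x i where x: "inverse \<theta> \<le> x" "i < n" "c - \<theta> < k i x"
      using frequently_near[OF \<theta>(1), of "inverse \<theta>"] by blast
    have window: "?V \<le> k j t" if "j < n" "x - X - real M * \<epsilon> \<le> t" "t < x - X" for j t
    proof -
      \<comment> \<open>The grid point is rounded up, so the chosen walk ends at most \<open>2 * \<epsilon>\<close> before \<open>t\<close> and never
        after it; this is the direction in which \<open>k j\<close> is regular.\<close>
      define m where "m = nat \<lceil>(x - t - X) / \<epsilon>\<rceil>"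
      have "0 \<le> (x - t - X) / \<epsilon>" using that \<epsilon> by simp
      then have m: "real m = of_int \<lceil>(x - t - X) / \<epsilon>\<rceil>" unfolding m_def by simp
      have "(x - t - X) / \<epsilon> \<le> real m" "real m < (x - t - X) / \<epsilon> + 1" unfolding m by linarith+
      then have m_bounds: "x - t - X \<le> real m * \<epsilon>" "real m * \<epsilon> < x - t - X + \<epsilon>"
        using \<epsilon> by (simp_all add: field_simps)
      have "(x - t - X) / \<epsilon> \<le> real M" using that(2) \<epsilon> by (simp add: field_simps)
      then have "m \<le> M" unfolding m_def by (simp add: nat_le_iff ceiling_le_iff)
      define l where "l = f i j m"
      have l: "x - l \<le> t" "t \<le> x - l + 2 * \<epsilon>"
        using f(2,3)[OF x(2) that(1), of m] m_bounds unfolding l_def by linarith+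
      have near: "c - \<epsilon> < k j (x - l)"
        unfolding l_def using \<theta>(2)[OF x(2) that(1) \<open>m \<le> M\<close> x(1,3)] .
      have "?V \<le> exp (- real d * (2 * \<epsilon>)) * k j (x - l)"
        using near by (intro mult_left_mono) auto
      also have "\<dots> \<le> exp (- real d * (t - (x - l))) * k j (x - l)"
        using l nonneg[OF that(1)] by (intro mult_right_mono) (auto intro!: mult_left_mono)
      also have "\<dots> \<le> k j ((x - l) + (t - (x - l)))"
        using l by (intro regular that) simp
      finally show ?thesis by simp
    qed
    have "?V \<le> k j t" if "j < n" "x - X - real M * \<epsilon> \<le> t" for j t
      using window _ that
    proof (rule forward_induct[where P = "\<lambda>j t. ?V \<le> k j t"])
      fix i t assume *: "i < n" "x - X \<le> t"
        and IH: "\<And>j \<alpha>. j < n \<Longrightarrow> \<alpha> \<in># E i j \<Longrightarrow> x - X - real M * \<epsilon> \<le> t + ln \<alpha> \<Longrightarrow> ?V \<le> k j (t + ln \<alpha>)"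
      have "?V = edge_sum i (\<lambda>j \<alpha>. \<alpha> ^ d * ?V)"
        by (simp add: edge_sum_multc edge_sum_volume[OF *(1)])
      also have "\<dots> \<le> edge_sum i (\<lambda>j \<alpha>. \<alpha> ^ d * k j (t + ln \<alpha>))"
      proof (rule edge_sum_mono)
        fix j \<alpha> assume ja: "j < n" "\<alpha> \<in># E i j"
        have "?V \<le> k j (t + ln \<alpha>)"
        proof (rule IH[OF ja])
          show "x - X - real M * \<epsilon> \<le> t + ln \<alpha>" using L(2)[OF *(1) ja] *(2) M by linarith
        qed
        then show "\<alpha> ^ d * ?V \<le> \<alpha> ^ d * k j (t + ln \<alpha>)"
          using scale_pos[OF *(1) ja] by (intro mult_left_mono) auto
      qed
      also have "\<dots> \<le> k i t" using harmonic[OF *(1), of t] s_nonneg[OF *(1), of t] by linarith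
      finally show "?V \<le> k i t" .
    qed
    then show ?thesis unfolding eventually_at_top_linorder by blast
  qed
  have "(k i \<longlongrightarrow> c) at_top" if "i < n" for i
  proof (rule order_tendstoI)
    fix a assume "c < a"
    from above[of "(a - c) / 2"] \<open>c < a\<close> have "\<forall>\<^sub>F x in at_top. \<forall>i<n. k i x \<le> c + (a - c) / 2" by simp
    then show "\<forall>\<^sub>F x in at_top. k i x < a"
    proof eventually_elim
      case (elim x)
      then have "k i x \<le> c + (a - c) / 2" using that by blast
      then show ?case using \<open>c < a\<close> by (simp add: field_simps)
    qed
  next
    fix a assume "a < c"
    have "((\<lambda>\<epsilon>. exp (- real d * (2 * \<epsilon>)) * (c - \<epsilon>)) \<longlongrightarrow> exp (- real d * (2 * 0)) * (c - 0)) (at_right 0)"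
      by (intro tendsto_intros)
    then have "\<forall>\<^sub>F \<epsilon> in at_right 0. a < exp (- real d * (2 * \<epsilon>)) * (c - \<epsilon>)"
      using \<open>a < c\<close> by (auto dest: order_tendstoD(1))
    then have "\<forall>\<^sub>F \<epsilon> in at_right 0. 0 < \<epsilon> \<and> a < exp (- real d * (2 * \<epsilon>)) * (c - \<epsilon>)"
      by (intro eventually_conj eventually_at_right_less)
    then obtain \<epsilon> where \<epsilon>: "0 < \<epsilon>" "a < exp (- real d * (2 * \<epsilon>)) * (c - \<epsilon>)"
      using eventually_happens'[OF trivial_limit_at_right_real] by blast
    from below[OF \<epsilon>(1)] show "\<forall>\<^sub>F x in at_top. a < k i x"
      by eventually_elim (use \<epsilon>(2) that in force)
  qed
  then show ?thesis by blast
qed simp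

lemma walk_count_asymptotics:
  assumes dense_walk_lengths
  shows "\<exists>c. \<forall>i<n. ((\<lambda>t. walk_count h i t * exp (- real d * t)) \<longlongrightarrow> c) at_top"
proof -
  obtain C where C: "\<And>i t. i < n \<Longrightarrow> walk_count h i t \<le> C * exp (real d * t)"
    using walk_count_bound by blast
  show ?thesis
  proof (rule harmonic_limit[OF assms, where C = C and s = "\<lambda>i t. delta h i t * exp (- real d * t)"])
    fix i x assume i: "i < n"
    show "0 \<le> walk_count h i x * exp (- real d * x)" using walk_count_nonneg[OF i] by simp
    show "walk_count h i x * exp (- real d * x) \<le> C"
      using mult_right_mono[OF C[OF i, of x], of "exp (- real d * x)"] by (simp add: mult.assoc flip: exp_add)
    show "0 \<le> delta h i x * exp (- real d * x)" by (simp add: delta_def)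
    have "edge_sum i (\<lambda>j \<alpha>. walk_count h j (x + ln \<alpha>)) * exp (- real d * x)
        = edge_sum i (\<lambda>j \<alpha>. \<alpha> ^ d * (walk_count h j (x + ln \<alpha>) * exp (- real d * (x + ln \<alpha>))))"
      unfolding edge_sum_multc[symmetric]
    proof (rule edge_sum_cong)
      fix j \<alpha> assume "j < n" "\<alpha> \<in># E i j"
      then have "0 < \<alpha>" using scale_pos i by blast
      then show "walk_count h j (x + ln \<alpha>) * exp (- real d * x)
          = \<alpha> ^ d * (walk_count h j (x + ln \<alpha>) * exp (- real d * (x + ln \<alpha>)))"
        by (simp add: distrib_left exp_add exp_minus exp_of_nat_mult exp_diff)
    qed
    then show "walk_count h i x * exp (- real d * x)
        = edge_sum i (\<lambda>j \<alpha>. \<alpha> ^ d * (walk_count h j (x + ln \<alpha>) * exp (- real d * (x + ln \<alpha>)))) + delta h i x * exp (- real d * x)"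
      by (subst solves_eq[OF solves_walk_count i]) (simp add: distrib_right)
    fix y :: real assume "0 \<le> y"
    have "exp (- real d * y) * (walk_count h i x * exp (- real d * x)) = walk_count h i x * exp (- real d * (x + y))"
      by (simp add: distrib_left exp_add exp_diff exp_minus field_simps)
    also have "\<dots> \<le> walk_count h i (x + y) * exp (- real d * (x + y))"
      using walk_count_mono[OF i] \<open>0 \<le> y\<close> by (intro mult_right_mono) auto
    finally show "exp (- real d * y) * (walk_count h i x * exp (- real d * x)) \<le> walk_count h i (x + y) * exp (- real d * (x + y))" .
  next
    fix i assume "i < n"
    have "((\<lambda>t. exp (- real d * t)) \<longlongrightarrow> 0) at_top"
      using d_pos by real_asymp
    then show "((\<lambda>t. delta h i t * exp (- real d * t)) \<longlongrightarrow> 0) at_top"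
      by (rule Lim_null_comparison[rotated]) (simp add: delta_def)
  qed
qed

end

section \<open>The limit constants\<close>

lemma tendsto_squeeze_family:
  fixes f :: "'a \<Rightarrow> real"
  assumes lower: "\<And>\<epsilon>. 0 < \<epsilon> \<Longrightarrow> \<forall>\<^sub>F t in F. l \<epsilon> t \<le> f t" "\<And>\<epsilon>. 0 < \<epsilon> \<Longrightarrow> (l \<epsilon> \<longlongrightarrow> l' \<epsilon>) F"
    and upper: "\<And>\<epsilon>. 0 < \<epsilon> \<Longrightarrow> \<forall>\<^sub>F t in F. f t \<le> u \<epsilon> t" "\<And>\<epsilon>. 0 < \<epsilon> \<Longrightarrow> (u \<epsilon> \<longlongrightarrow> u' \<epsilon>) F"
    and lims: "(l' \<longlongrightarrow> c) (at_right (0::real))" "(u' \<longlongrightarrow> c) (at_right (0::real))"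
  shows "(f \<longlongrightarrow> c) F"
proof (rule order_tendstoI)
  fix a assume "a < c"
  have "\<forall>\<^sub>F \<epsilon> in at_right 0. 0 < \<epsilon> \<and> a < l' \<epsilon>"
    using order_tendstoD(1)[OF lims(1) \<open>a < c\<close>] eventually_at_right_less[of "0::real"] by eventually_elim simp
  from eventually_happens'[OF trivial_limit_at_right_real this]
  obtain \<epsilon> where \<epsilon>: "0 < \<epsilon>" "a < l' \<epsilon>" by blast
  show "\<forall>\<^sub>F t in F. a < f t"
    using order_tendstoD(1)[OF lower(2)[OF \<epsilon>(1)] \<epsilon>(2)] lower(1)[OF \<epsilon>(1)]
    by eventually_elim linarith
next
  fix a assume "c < a"
  have "\<forall>\<^sub>F \<epsilon> in at_right 0. 0 < \<epsilon> \<and> u' \<epsilon> < a"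
    using order_tendstoD(2)[OF lims(2) \<open>c < a\<close>] eventually_at_right_less[of "0::real"] by eventually_elim simp
  from eventually_happens'[OF trivial_limit_at_right_real this]
  obtain \<epsilon> where \<epsilon>: "0 < \<epsilon>" "u' \<epsilon> < a" by blast
  show "\<forall>\<^sub>F t in F. f t < a"
    using order_tendstoD(2)[OF upper(2)[OF \<epsilon>(1)] \<epsilon>(2)] upper(1)[OF \<epsilon>(1)]
    by eventually_elim linarith
qed

context substitution_graph
begin

lemma solves_cong:
  "solves w u \<Longrightarrow> (\<And>i t. i < n \<Longrightarrow> w i t = w' i t) \<Longrightarrow> solves w' u"
  by (simp add: solves_def)

context
  fixes c :: "nat \<Rightarrow> real"
  assumes walk_limit: "\<And>h i. i < n \<Longrightarrow> ((\<lambda>t. walk_count h i t * exp (- real d * t)) \<longlongrightarrow> c h) at_top"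
begin

lemma walk_limit_shift:
  assumes "i < n"
  shows "((\<lambda>t. walk_count h i (t - s) * exp (- real d * t)) \<longlongrightarrow> c h * exp (- real d * s)) at_top"
proof -
  have "filterlim (\<lambda>t. - s + t) at_top (at_top :: real filter)"
    by (intro filterlim_tendsto_add_at_top[OF tendsto_const] filterlim_ident)
  then have "filterlim (\<lambda>t. t - s) at_top (at_top :: real filter)" by simp
  from filterlim_compose[OF walk_limit[OF assms] this]
  have "((\<lambda>t. walk_count h i (t - s) * exp (- real d * (t - s)) * exp (- real d * s)) \<longlongrightarrow> c h * exp (- real d * s)) at_top"
    by (intro tendsto_intros)
  then show ?thesis by (simp add: mult.assoc right_diff_distrib flip: exp_add)
qed

text \<open>The renewal equation splits off the first edge of a walk. The right-hand side, which splits
  off the last one, solves the same equation.\<close>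
lemma walk_count_last_edge:
  assumes "i < n" "j < n"
  shows "walk_count j i t = (\<Sum>h<n. \<Sum>\<alpha>\<in>#E h j. walk_count h i (t - - ln \<alpha>)) + delta j i t"
proof -
  have "solves (\<lambda>i t. \<Sum>h<n. \<Sum>\<alpha>\<in>#E h j. delta h i (t - - ln \<alpha>))
      (\<lambda>i t. \<Sum>h<n. \<Sum>\<alpha>\<in>#E h j. walk_count h i (t - - ln \<alpha>))"
    using scale_bounds[OF _ \<open>j < n\<close>]
    by (intro solves_sum solves_sum_mset solves_shift[OF solves_walk_count]) (auto simp: less_imp_le)
  moreover have "solves (\<lambda>i t. delta j i t - edge_sum i (\<lambda>g \<alpha>. delta j g (t + ln \<alpha>))) (delta j)"
    by (simp add: solves_def delta_def)
  ultimately have "solves (\<lambda>i t. (\<Sum>h<n. \<Sum>\<alpha>\<in>#E h j. delta h i (t - - ln \<alpha>)) + (delta j i t - edge_sum i (\<lambda>g \<alpha>. delta j g (t + ln \<alpha>))))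
     (\<lambda>i t. (\<Sum>h<n. \<Sum>\<alpha>\<in>#E h j. walk_count h i (t - - ln \<alpha>)) + delta j i t)"
    by (rule solves_add)
  then have "solves (delta j) (\<lambda>i t. (\<Sum>h<n. \<Sum>\<alpha>\<in>#E h j. walk_count h i (t - - ln \<alpha>)) + delta j i t)"
  proof (rule solves_cong)
    fix i t assume "i < n"
    have "(\<Sum>h<n. \<Sum>\<alpha>\<in>#E h j. delta h i (t - - ln \<alpha>))
        = (\<Sum>h<n. if h = i then \<Sum>\<alpha>\<in>#E i j. delta i i (t + ln \<alpha>) else 0)"
      by (intro sum.cong) (auto simp: delta_def)
    also have "\<dots> = (\<Sum>\<alpha>\<in>#E i j. delta i i (t + ln \<alpha>))" using \<open>i < n\<close> by simp
    also have "\<dots> = (\<Sum>g<n. if g = j then \<Sum>\<alpha>\<in>#E i j. delta j j (t + ln \<alpha>) else 0)"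
      using \<open>j < n\<close> by (simp add: delta_def)
    also have "\<dots> = edge_sum i (\<lambda>g \<alpha>. delta j g (t + ln \<alpha>))"
      unfolding edge_sum_def by (intro sum.cong) (auto simp: delta_def)
    finally show "(\<Sum>h<n. \<Sum>\<alpha>\<in>#E h j. delta h i (t - - ln \<alpha>)) + (delta j i t - edge_sum i (\<lambda>g \<alpha>. delta j g (t + ln \<alpha>))) = delta j i t"
      by simp
  qed
  from solves_unique[OF solves_walk_count this \<open>i < n\<close>] show ?thesis .
qed

lemma walk_limit_left_invariant:
  assumes "j < n"
  shows "c j = (\<Sum>h<n. c h * (\<Sum>\<alpha>\<in>#E h j. \<alpha> ^ d))"
proof -
  have "((\<lambda>t. delta j j t * exp (- real d * t)) \<longlongrightarrow> 0) at_top"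
  proof (rule Lim_null_comparison)
    show "((\<lambda>t. exp (- real d * t)) \<longlongrightarrow> 0) at_top" using d_pos by real_asymp
  qed (simp add: delta_def)
  then have "((\<lambda>t. (\<Sum>h<n. \<Sum>\<alpha>\<in>#E h j. walk_count h j (t - - ln \<alpha>) * exp (- real d * t)) + delta j j t * exp (- real d * t))
     \<longlongrightarrow> (\<Sum>h<n. \<Sum>\<alpha>\<in>#E h j. c h * exp (- real d * - ln \<alpha>)) + 0) at_top"
    by (intro tendsto_add tendsto_sum tendsto_sum_mset walk_limit_shift assms)
  moreover have "(\<lambda>t. (\<Sum>h<n. \<Sum>\<alpha>\<in>#E h j. walk_count h j (t - - ln \<alpha>) * exp (- real d * t)) + delta j j t * exp (- real d * t))
      = (\<lambda>t. walk_count j j t * exp (- real d * t))"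
    by (simp only: walk_count_last_edge[OF assms assms] distrib_right sum_distrib_right sum_mset_distrib_right)
  ultimately have "((\<lambda>t. walk_count j j t * exp (- real d * t))
      \<longlongrightarrow> (\<Sum>h<n. \<Sum>\<alpha>\<in>#E h j. c h * exp (- real d * - ln \<alpha>)) + 0) at_top"
    by (simp only:)
  from tendsto_unique[OF trivial_limit_at_top_linorder this walk_limit[OF assms]]
  have "(\<Sum>h<n. \<Sum>\<alpha>\<in>#E h j. c h * exp (- real d * - ln \<alpha>)) + 0 = c j" .
  moreover have "(\<Sum>h<n. \<Sum>\<alpha>\<in>#E h j. c h * exp (- real d * - ln \<alpha>)) = (\<Sum>h<n. c h * (\<Sum>\<alpha>\<in>#E h j. \<alpha> ^ d))"
  proof (rule sum.cong)
    fix h assume h: "h \<in> {..<n}"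
    have "(\<Sum>\<alpha>\<in>#E h j. c h * exp (- real d * - ln \<alpha>)) = (\<Sum>\<alpha>\<in>#E h j. c h * \<alpha> ^ d)"
      using scale_pos[of h j] h assms by (intro arg_cong[of _ _ sum_mset] image_mset_cong) (simp add: exp_of_nat_mult)
    then show "(\<Sum>\<alpha>\<in>#E h j. c h * exp (- real d * - ln \<alpha>)) = c h * (\<Sum>\<alpha>\<in>#E h j. \<alpha> ^ d)"
      by (simp only: sum_mset_cmult)
  qed simp
  ultimately show ?thesis by simp
qed

text \<open>The volume that the tile of scale \<open>exp t\<close> sheds at once, in children of scale less than 1.\<close>
definition volume_source :: "nat \<Rightarrow> real \<Rightarrow> real" where
  "volume_source i t = (if 0 \<le> t then edge_sum i (\<lambda>j \<alpha>. \<alpha> ^ d * (if t < - ln \<alpha> then exp (real d * t) else 0)) else 0)"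

lemma solves_volume: "solves volume_source (\<lambda>i t. if 0 \<le> t then exp (real d * t) else 0)"
  unfolding solves_def
proof (intro allI impI conjI)
  fix i t assume i: "i < n"
  show "(if 0 \<le> t then exp (real d * t) else 0)
    = edge_sum i (\<lambda>j \<alpha>. if 0 \<le> t + ln \<alpha> then exp (real d * (t + ln \<alpha>)) else 0) + volume_source i t"
  proof (cases "0 \<le> t")
    case True
    have "exp (real d * t) = edge_sum i (\<lambda>j \<alpha>. \<alpha> ^ d * exp (real d * t))"
      by (simp add: edge_sum_multc edge_sum_volume[OF i])
    also have "\<dots> = edge_sum i (\<lambda>j \<alpha>. (if 0 \<le> t + ln \<alpha> then exp (real d * (t + ln \<alpha>)) else 0)
        + \<alpha> ^ d * (if t < - ln \<alpha> then exp (real d * t) else 0))"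
      using scale_pos[OF i] by (intro edge_sum_cong) (auto simp: exp_mult_ln)
    finally show ?thesis using True by (simp add: edge_sum_add volume_source_def)
  next
    case False
    have "edge_sum i (\<lambda>j \<alpha>. if 0 \<le> t + ln \<alpha> then exp (real d * (t + ln \<alpha>)) else 0) = edge_sum i (\<lambda>j \<alpha>. 0)"
    proof (rule edge_sum_cong)
      fix j \<alpha> assume "j < n" "\<alpha> \<in># E i j"
      then have "ln \<alpha> < 0" using scale_bounds i by (simp add: ln_less_zero)
      then show "(if 0 \<le> t + ln \<alpha> then exp (real d * (t + ln \<alpha>)) else 0) = 0" using False by simp
    qed
    then show ?thesis using False by (simp add: volume_source_def)
  qed
qed simp

text \<open>A combination of differences of \<open>f\<close> over the \<open>N\<close> parts of a window of length \<open>v\<close>, weighted by the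
  values of \<open>exp (d * t)\<close> at the left ends (\<open>\<theta> = 0\<close>) or at the right ends (\<open>\<theta> = 1\<close>) of the parts. For a unit jump \<open>f\<close>
  this is a step function below or above \<open>exp (d * t)\<close> on the window.\<close>
definition riemann :: "real \<Rightarrow> nat \<Rightarrow> real \<Rightarrow> (real \<Rightarrow> real) \<Rightarrow> real \<Rightarrow> real" where
  "riemann \<theta> N v f t = (\<Sum>m<N. exp (real d * ((real m + \<theta>) * v / real N)) *
     (f (t - real m * v / real N) - f (t - real (Suc m) * v / real N)))"

lemma riemann_tendsto:
  assumes "i < n" "0 < N"
  shows "((\<lambda>t. riemann \<theta> N v (walk_count h i) t * exp (- real d * t))
     \<longlongrightarrow> c h * (real N * exp (real d * (\<theta> * v / real N)) * (1 - exp (- real d * (v / real N))))) at_top"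
proof -
  have "((\<lambda>t. \<Sum>m<N. exp (real d * ((real m + \<theta>) * v / real N)) *
      (walk_count h i (t - real m * v / real N) * exp (- real d * t) - walk_count h i (t - real (Suc m) * v / real N) * exp (- real d * t)))
     \<longlongrightarrow> (\<Sum>m<N. exp (real d * ((real m + \<theta>) * v / real N)) *
      (c h * exp (- real d * (real m * v / real N)) - c h * exp (- real d * (real (Suc m) * v / real N))))) at_top"
    by (intro tendsto_intros walk_limit_shift assms)
  moreover have "exp (real d * ((real m + \<theta>) * v / real N)) *
      (c h * exp (- real d * (real m * v / real N)) - c h * exp (- real d * (real (Suc m) * v / real N)))
    = c h * (exp (real d * (\<theta> * v / real N)) * (1 - exp (- real d * (v / real N))))" for m
  proof -
    have a: "exp (real d * ((real m + \<theta>) * v / real N)) = exp (real d * (real m * v / real N)) * exp (real d * (\<theta> * v / real N))"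
      by (simp add: add_divide_distrib distrib_left distrib_right flip: exp_add)
    have b: "exp (- real d * (real (Suc m) * v / real N)) = exp (- real d * (real m * v / real N)) * exp (- real d * (v / real N))"
      by (simp add: add_divide_distrib distrib_left distrib_right flip: exp_add)
    have e: "exp (real d * (real m * v / real N)) * exp (- real d * (real m * v / real N)) = 1"
      by (simp flip: exp_add)
    have cancel: "P * R * (x * Q - x * (Q * S)) = x * (R * (1 - S))" if "P * Q = 1" for P Q R S x :: real
    proof -
      have "P * R * (x * Q - x * (Q * S)) = (P * Q) * (x * (R * (1 - S)))"
        by (simp add: algebra_simps)
      then show ?thesis using that by simp
    qed
    show ?thesis unfolding a b by (rule cancel[OF e])
  qed
  ultimately show ?thesis
    by (simp add: riemann_def sum_distrib_right mult.assoc left_diff_distrib mult.left_commute[of "real N"])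
qed

lemma riemann_source:
  assumes "0 < N" "0 \<le> v"
  shows "riemann 0 N v (delta i i) t \<le> (if 0 \<le> t \<and> t < v then exp (real d * t) else 0)"
    and "(if 0 \<le> t \<and> t < v then exp (real d * t) else 0) \<le> riemann 1 N v (delta i i) t"
proof -
  let ?ind = "\<lambda>m. delta i i (t - real m * v / real N) - delta i i (t - real (Suc m) * v / real N)"
  have "(\<Sum>m<N. ?ind m) = delta i i (t - real 0 * v / real N) - delta i i (t - real N * v / real N)"
    by (rule sum_lessThan_telescope')
  also have "\<dots> = (if 0 \<le> t \<and> t < v then 1 else 0)"
    using assms by (auto simp: delta_def)
  finally have sum: "(\<Sum>m<N. exp (real d * t) * ?ind m) = (if 0 \<le> t \<and> t < v then exp (real d * t) else 0)"
    by (simp only: flip: sum_distrib_left) simp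
  have mono: "real m * v / real N \<le> real (Suc m) * v / real N" for m
    using assms by (intro divide_right_mono mult_right_mono) auto
  have ind_nonneg: "0 \<le> ?ind m" for m
    using mono[of m] by (auto simp: delta_def simp del: of_nat_Suc)
  have ind_time: "real m * v / real N \<le> t" "t \<le> real (Suc m) * v / real N" if "?ind m \<noteq> 0" for m
    using that mono[of m] by (auto simp: delta_def simp del: of_nat_Suc split: if_splits)
  have "riemann 0 N v (delta i i) t \<le> (\<Sum>m<N. exp (real d * t) * ?ind m)"
    unfolding riemann_def
  proof (rule sum_mono)
    fix m
    have "exp (real d * ((real m + 0) * v / real N)) \<le> exp (real d * t)" if "?ind m \<noteq> 0"
      unfolding add_0_right exp_le_cancel_iff using ind_time(1)[OF that] by (rule mult_left_mono) simp
    then show "exp (real d * ((real m + 0) * v / real N)) * ?ind m \<le> exp (real d * t) * ?ind m"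
      using ind_nonneg[of m] by (cases "?ind m = 0") (auto simp del: of_nat_Suc intro: mult_right_mono)
  qed
  then show "riemann 0 N v (delta i i) t \<le> (if 0 \<le> t \<and> t < v then exp (real d * t) else 0)"
    unfolding sum .
  have "(\<Sum>m<N. exp (real d * t) * ?ind m) \<le> riemann 1 N v (delta i i) t"
    unfolding riemann_def
  proof (rule sum_mono)
    fix m
    have Suc: "real m + 1 = real (Suc m)" by simp
    have "exp (real d * t) \<le> exp (real d * ((real m + 1) * v / real N))" if "?ind m \<noteq> 0"
      unfolding Suc exp_le_cancel_iff using ind_time(2)[OF that] by (rule mult_left_mono) simp
    then show "exp (real d * t) * ?ind m \<le> exp (real d * ((real m + 1) * v / real N)) * ?ind m"
      using ind_nonneg[of m] by (cases "?ind m = 0") (auto simp del: of_nat_Suc intro: mult_right_mono)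
  qed
  then show "(if 0 \<le> t \<and> t < v then exp (real d * t) else 0) \<le> riemann 1 N v (delta i i) t"
    unfolding sum .
qed

text \<open>The solution with source \<open>volume_source\<close> is \<open>exp (d * t)\<close>, whose normalized limit is 1. Squeezing the
  source between step functions squeezes this limit between Riemann sums over walk
  counts, and these tend to the left-hand side as the partition is refined.\<close>
lemma walk_limit_normalized:
  assumes "0 < n"
  shows "(\<Sum>h<n. c h * edge_sum h (\<lambda>j \<alpha>. \<alpha> ^ d * (real d * - ln \<alpha>))) = 1"
proof -
  define u where "u \<theta> N i t = (\<Sum>h<n. edge_sum h (\<lambda>j \<alpha>. \<alpha> ^ d * riemann \<theta> N (- ln \<alpha>) (walk_count h i) t))" for \<theta> N i t
  define w where "w \<theta> N i t = (\<Sum>h<n. edge_sum h (\<lambda>j \<alpha>. \<alpha> ^ d * riemann \<theta> N (- ln \<alpha>) (delta h i) t))" for \<theta> N i t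
  define M where "M \<theta> N = (\<Sum>h<n. edge_sum h (\<lambda>j \<alpha>. \<alpha> ^ d * (c h * (real N * exp (real d * (\<theta> * - ln \<alpha> / real N)) * (1 - exp (- real d * (- ln \<alpha> / real N)))))))" for \<theta> N
  define U where "U i t = (if 0 \<le> t then exp (real d * t) else 0)" for i :: nat and t
  have length_nonneg: "0 \<le> - ln \<alpha>" if "h < n" "j < n" "\<alpha> \<in># E h j" for h j \<alpha>
    using scale_bounds[OF that] by (simp add: less_imp_le)
  have u: "solves (w \<theta> N) (u \<theta> N)" if "0 < N" for \<theta> N
    unfolding w_def u_def riemann_def
    by (intro solves_sum solves_edge_sum solves_cmult solves_diff solves_shift solves_walk_count finite_lessThan
        divide_nonneg_nonneg mult_nonneg_nonneg length_nonneg of_nat_0_le_iff) auto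
  have u_lim: "((\<lambda>t. u \<theta> N 0 t * exp (- real d * t)) \<longlongrightarrow> M \<theta> N) at_top" if "0 < N" for \<theta> N
    unfolding u_def M_def sum_distrib_right edge_sum_multc[symmetric] mult.assoc[of "_ ^ d"]
    by (intro tendsto_sum edge_sum_tendsto tendsto_mult_left riemann_tendsto that assms)
  have w_single: "w \<theta> N i t = edge_sum i (\<lambda>j \<alpha>. \<alpha> ^ d * riemann \<theta> N (- ln \<alpha>) (delta i i) t)" if "i < n" for \<theta> N i t
  proof -
    have "riemann \<theta> N v (delta h i) t = 0" if "h \<noteq> i" for h v
      using that by (simp add: riemann_def delta_def)
    then have "w \<theta> N i t = (\<Sum>h<n. if h = i then edge_sum i (\<lambda>j \<alpha>. \<alpha> ^ d * riemann \<theta> N (- ln \<alpha>) (delta i i) t) else 0)"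
      unfolding w_def by (intro sum.cong) auto
    then show ?thesis using \<open>i < n\<close> by simp
  qed
  have source: "volume_source i t = edge_sum i (\<lambda>j \<alpha>. \<alpha> ^ d * (if 0 \<le> t \<and> t < - ln \<alpha> then exp (real d * t) else 0))" for i t
    by (simp add: volume_source_def cong: if_cong)
  have w_lower: "w 0 N i t \<le> volume_source i t" and w_upper: "volume_source i t \<le> w 1 N i t" if "i < n" "0 < N" for i t N
    unfolding w_single[OF \<open>i < n\<close>] source
    by (intro edge_sum_mono mult_left_mono riemann_source length_nonneg[OF \<open>i < n\<close>] that zero_le_power less_imp_le[OF scale_pos[OF \<open>i < n\<close>]]; assumption)+
  have volume: "solves volume_source U"
    using solves_volume by (simp add: U_def[abs_def])
  have U_lim: "((\<lambda>t. U 0 t * exp (- real d * t)) \<longlongrightarrow> 1) at_top"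
  proof (rule tendsto_eventually)
    show "\<forall>\<^sub>F t in at_top. U 0 t * exp (- real d * t) = 1"
      using eventually_ge_at_top[of 0] by eventually_elim (simp add: U_def flip: exp_add)
  qed
  have lower: "M 0 N \<le> 1" and upper: "1 \<le> M 1 N" if "0 < N" for N
    using solves_mono[OF u[OF that] volume w_lower] solves_mono[OF volume u[OF that] w_upper] assms that
    by (intro tendsto_le[OF _ U_lim u_lim[OF that]] tendsto_le[OF _ u_lim[OF that] U_lim]; simp)+
  let ?r = "\<Sum>h<n. edge_sum h (\<lambda>j \<alpha>. \<alpha> ^ d * (c h * (real d * - ln \<alpha>)))"
  have M_lim: "(\<lambda>N. M \<theta> N) \<longlonglongrightarrow> ?r" for \<theta>
  proof -
    have "(\<lambda>N. real N * exp (real d * (\<theta> * v / real N)) * (1 - exp (- real d * (v / real N)))) \<longlonglongrightarrow> real d * v" for v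
      by real_asymp
    then show ?thesis unfolding M_def
      by (intro tendsto_sum edge_sum_tendsto tendsto_mult_left)
  qed
  have "?r \<le> 1"
    by (rule tendsto_upperbound[OF M_lim[of 0]]) (auto intro: eventually_mono[OF eventually_gt_at_top[of 0]] lower)
  moreover have "1 \<le> ?r"
    by (rule tendsto_lowerbound[OF M_lim[of 1]]) (auto intro: eventually_mono[OF eventually_gt_at_top[of 0]] upper)
  ultimately have "?r = 1" by simp
  moreover have "?r = (\<Sum>h<n. c h * edge_sum h (\<lambda>j \<alpha>. \<alpha> ^ d * (real d * - ln \<alpha>)))"
    by (simp only: edge_sum_cmult[symmetric] mult.left_commute[of "c _"])
  ultimately show ?thesis by simp
qed

text \<open>Shifting one end of the window by \<open>\<epsilon>\<close> absorbs all questions of endpoints, because the limit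
  depends continuously on the window. If \<open>b \<le> \<alpha>\<close>, both ends of the window are 0 and the
  contribution vanishes, as it must for a tile whose parent would have scale at most 1.\<close>
lemma window_count_asymptotics:
  assumes F: "solves (\<lambda>i t. if 0 < t then \<Sum>\<alpha>\<in>#E i j. if \<alpha> * exp t \<in> {a..b} then 1 else 0 else 0) F"
    and "i < n" "j < n" "a \<le> b"
  shows "((\<lambda>t. F i t * exp (- real d * t)) \<longlongrightarrow>
     (\<Sum>h<n. c h * (\<Sum>\<alpha>\<in>#E h j. \<alpha> ^ d * (inverse (max a \<alpha> ^ d) - inverse (max b \<alpha> ^ d))))) at_top"
proof -
  define f where "f x \<alpha> = ln (max x \<alpha> / \<alpha>)" for x \<alpha> :: real
  have \<alpha>: "0 < \<alpha>" if "h < n" "\<alpha> \<in># E h j" for h \<alpha> using scale_pos[OF that(1) \<open>j < n\<close> that(2)] .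
  have f_nonneg: "0 \<le> f x \<alpha>" if "0 < \<alpha>" for x \<alpha> using that by (simp add: f_def)
  have f_exp: "max x \<alpha> = \<alpha> * exp (f x \<alpha>)" if "0 < \<alpha>" for x \<alpha>
    using that by (simp add: f_def)
  have f_mono: "f a \<alpha> \<le> f b \<alpha>" if "0 < \<alpha>" for \<alpha>
    using that \<open>a \<le> b\<close> by (auto simp: f_def intro!: ln_mono divide_right_mono)
  have f_weight: "exp (- (real d * f x \<alpha>)) = \<alpha> ^ d * inverse (max x \<alpha> ^ d)" if "0 < \<alpha>" for x \<alpha>
    using that by (simp add: f_exp power_mult_distrib exp_minus exp_of_nat_mult)
  define u where "u y z i t = (\<Sum>h<n. \<Sum>\<alpha>\<in>#E h j. walk_count h i (t - (f a \<alpha> + y)) - walk_count h i (t - (f b \<alpha> + z)))" for y z i t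
  define w where "w y z i t = (\<Sum>h<n. \<Sum>\<alpha>\<in>#E h j. delta h i (t - (f a \<alpha> + y)) - delta h i (t - (f b \<alpha> + z)))" for y z i t
  define M where "M y z = (\<Sum>h<n. \<Sum>\<alpha>\<in>#E h j. c h * exp (- real d * (f a \<alpha> + y)) - c h * exp (- real d * (f b \<alpha> + z)))" for y z
  have u: "solves (w y z) (u y z)" if "0 \<le> y" "0 \<le> z" for y z
    unfolding w_def u_def
    by (intro solves_sum solves_sum_mset solves_diff solves_shift solves_walk_count finite_lessThan add_nonneg_nonneg f_nonneg that \<alpha>; simp)
  have u_lim: "((\<lambda>t. u y z i t * exp (- real d * t)) \<longlongrightarrow> M y z) at_top" for y z
    unfolding u_def M_def sum_distrib_right sum_mset_distrib_right left_diff_distrib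
    by (intro tendsto_sum tendsto_sum_mset tendsto_diff walk_limit_shift \<open>i < n\<close>)
  have w_single: "w y z i t = (\<Sum>\<alpha>\<in>#E i j. delta i i (t - (f a \<alpha> + y)) - delta i i (t - (f b \<alpha> + z)))" if "i < n" for y z i t
  proof -
    have "w y z i t = (\<Sum>h<n. if h = i then \<Sum>\<alpha>\<in>#E i j. delta i i (t - (f a \<alpha> + y)) - delta i i (t - (f b \<alpha> + z)) else 0)"
      unfolding w_def by (intro sum.cong) (auto simp: delta_def)
    then show ?thesis using \<open>i < n\<close> by simp
  qed
  let ?w = "\<lambda>i t. if 0 < t then \<Sum>\<alpha>\<in>#E i j. if \<alpha> * exp t \<in> {a..b} then 1 else 0 else 0 :: real"
  have source: "?w i t = (\<Sum>\<alpha>\<in>#E i j. if 0 < t \<and> \<alpha> * exp t \<in> {a..b} then 1 else 0)" for i t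
    by simp
  have upper: "?w i t \<le> w 0 \<epsilon> i t" if "i < n" "0 < \<epsilon>" for i t \<epsilon>
    unfolding w_single[OF \<open>i < n\<close>] source
  proof (rule sum_mset_mono)
    fix \<alpha> assume "\<alpha> \<in># E i j"
    then have "0 < \<alpha>" using \<alpha> \<open>i < n\<close> by blast
    have "f a \<alpha> \<le> t \<and> t \<le> f b \<alpha>" if t: "0 < t" "a \<le> \<alpha> * exp t" "\<alpha> * exp t \<le> b"
    proof -
      have "\<alpha> * 1 \<le> \<alpha> * exp t" using t(1) \<open>0 < \<alpha>\<close> by (intro mult_left_mono) auto
      then have "\<alpha> * exp (f a \<alpha>) \<le> \<alpha> * exp t" "\<alpha> * exp t \<le> \<alpha> * exp (f b \<alpha>)"
        using t by (simp_all flip: f_exp[OF \<open>0 < \<alpha>\<close>])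
      then show ?thesis using \<open>0 < \<alpha>\<close> by simp
    qed
    then show "(if 0 < t \<and> \<alpha> * exp t \<in> {a..b} then 1 else 0) \<le> delta i i (t - (f a \<alpha> + 0)) - delta i i (t - (f b \<alpha> + \<epsilon>))"
      using f_mono[OF \<open>0 < \<alpha>\<close>] \<open>0 < \<epsilon>\<close> by (auto simp: delta_def)
  qed
  have lower: "w \<epsilon> 0 i t \<le> ?w i t" if "i < n" "0 < \<epsilon>" for i t \<epsilon>
    unfolding w_single[OF \<open>i < n\<close>] source
  proof (rule sum_mset_mono)
    fix \<alpha> assume "\<alpha> \<in># E i j"
    then have "0 < \<alpha>" using \<alpha> \<open>i < n\<close> by blast
    have "0 < t \<and> \<alpha> * exp t \<in> {a..b}" if t: "f a \<alpha> + \<epsilon> \<le> t" "t < f b \<alpha>"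
    proof -
      have "0 < t" using t f_nonneg[OF \<open>0 < \<alpha>\<close>, of a] \<open>0 < \<epsilon>\<close> by linarith
      have "exp (f a \<alpha>) \<le> exp t" "exp t < exp (f b \<alpha>)" using t \<open>0 < \<epsilon>\<close> by auto
      then have le: "max a \<alpha> \<le> \<alpha> * exp t" "\<alpha> * exp t < max b \<alpha>" using \<open>0 < \<alpha>\<close> by (simp_all add: f_exp)
      have "\<alpha> * 1 \<le> \<alpha> * exp t" using \<open>0 < t\<close> \<open>0 < \<alpha>\<close> by (intro mult_left_mono) auto
      then show ?thesis using le \<open>0 < t\<close> by auto
    qed
    then show "delta i i (t - (f a \<alpha> + \<epsilon>)) - delta i i (t - (f b \<alpha> + 0)) \<le> (if 0 < t \<and> \<alpha> * exp t \<in> {a..b} then 1 else 0)"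
      by (auto simp: delta_def)
  qed
  have M0: "M 0 0 = (\<Sum>h<n. c h * (\<Sum>\<alpha>\<in>#E h j. \<alpha> ^ d * (inverse (max a \<alpha> ^ d) - inverse (max b \<alpha> ^ d))))"
    unfolding M_def sum_mset_cmult[symmetric] using \<alpha>
    by (intro sum.cong arg_cong[of _ _ sum_mset] image_mset_cong refl) (simp add: f_weight algebra_simps)
  have "((\<lambda>t. F i t * exp (- real d * t)) \<longlongrightarrow> M 0 0) at_top"
  proof (rule tendsto_squeeze_family[where l = "\<lambda>\<epsilon> t. u \<epsilon> 0 i t * exp (- real d * t)" and u = "\<lambda>\<epsilon> t. u 0 \<epsilon> i t * exp (- real d * t)"
        and l' = "\<lambda>\<epsilon>. M \<epsilon> 0" and u' = "\<lambda>\<epsilon>. M 0 \<epsilon>"])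
    fix \<epsilon> :: real assume "0 < \<epsilon>"
    show "\<forall>\<^sub>F t in at_top. u \<epsilon> 0 i t * exp (- real d * t) \<le> F i t * exp (- real d * t)"
      using solves_mono[OF u F lower \<open>i < n\<close>] \<open>0 < \<epsilon>\<close> by simp
    show "\<forall>\<^sub>F t in at_top. F i t * exp (- real d * t) \<le> u 0 \<epsilon> i t * exp (- real d * t)"
      using solves_mono[OF F u upper \<open>i < n\<close>] \<open>0 < \<epsilon>\<close> by simp
  next
    show "((\<lambda>\<epsilon>. M \<epsilon> 0) \<longlongrightarrow> M 0 0) (at_right 0)" "((\<lambda>\<epsilon>. M 0 \<epsilon>) \<longlongrightarrow> M 0 0) (at_right 0)"
      unfolding M_def by (intro tendsto_sum tendsto_sum_mset tendsto_intros)+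
  qed (rule u_lim)+
  then show ?thesis unfolding M0 .
qed

end

end

section \<open>The adjugate of a singular stochastic matrix\<close>

lemma index_mult_mat_sum:
  assumes "A \<in> carrier_mat n n" "B \<in> carrier_mat n n" "i < n" "j < n"
  shows "(A * B) $$ (i, j) = (\<Sum>k<n. A $$ (i, k) * B $$ (k, j))"
  using assms by (simp add: scalar_prod_def atLeast0LessThan)

text \<open>At a vertex where \<open>norm (v i)\<close> is maximal, all successors have the same norm; such vertices
  lead to 0, where \<open>v\<close> vanishes.\<close>
lemma stochastic_maximum_principle:
  fixes v :: "nat \<Rightarrow> complex" and p :: "nat \<Rightarrow> nat \<Rightarrow> real"
  assumes nonneg: "\<And>i j. i < n \<Longrightarrow> j < n \<Longrightarrow> 0 \<le> p i j"
    and stochastic: "\<And>i. i < n \<Longrightarrow> (\<Sum>j<n. p i j) = 1"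
    and reach: "\<And>i. i < n \<Longrightarrow> (i, 0) \<in> {(i, j). i < n \<and> j < n \<and> 0 < p i j}\<^sup>*"
    and v0: "v 0 = 0"
    and harmonic: "\<And>i. 0 < i \<Longrightarrow> i < n \<Longrightarrow> v i = (\<Sum>j<n. of_real (p i j) * v j)"
    and "i < n"
  shows "v i = 0"
proof -
  define m where "m = Max ((\<lambda>i. norm (v i)) ` {..<n})"
  have "(\<lambda>i. norm (v i)) ` {..<n} \<noteq> {}" using \<open>i < n\<close> by auto
  then have "m \<in> (\<lambda>i. norm (v i)) ` {..<n}" unfolding m_def by (intro Max_in) auto
  then obtain i0 where i0: "i0 < n" "norm (v i0) = m" by auto
  have le: "norm (v j) \<le> m" if "j < n" for j
    unfolding m_def using that by (intro Max_ge) auto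
  have "norm (v k) = m" if "(i0, k) \<in> {(i, j). i < n \<and> j < n \<and> 0 < p i j}\<^sup>*" for k
    using that
  proof (induction rule: rtrancl_induct)
    case base then show ?case by (rule i0(2))
  next
    case (step j k)
    then have jk: "j < n" "k < n" "0 < p j k" by auto
    show ?case
    proof (rule ccontr)
      assume "norm (v k) \<noteq> m"
      then have less: "norm (v k) < m" using le[OF jk(2)] by simp
      have "j \<noteq> 0" using step.IH less v0 norm_ge_zero[of "v k"] by (metis norm_zero not_less)
      then have "v j = (\<Sum>l<n. of_real (p j l) * v l)" using harmonic jk(1) by simp
      then have "m = norm (\<Sum>l<n. of_real (p j l) * v l)" using step.IH by simp
      also have "\<dots> \<le> (\<Sum>l<n. p j l * norm (v l))"
        using nonneg[OF jk(1)] by (intro order_trans[OF norm_sum] sum_mono) (simp add: norm_mult)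
      also have "\<dots> < (\<Sum>l<n. p j l * m)"
      proof (rule sum_strict_mono_ex1)
        show "\<forall>l\<in>{..<n}. p j l * norm (v l) \<le> p j l * m"
          using nonneg[OF jk(1)] le by (auto intro!: mult_left_mono)
        show "\<exists>l\<in>{..<n}. p j l * norm (v l) < p j l * m"
          by (rule bexI[of _ k]) (use jk less in auto)
      qed simp
      also have "\<dots> = m" by (simp add: stochastic[OF jk(1)] flip: sum_distrib_right)
      finally show False by simp
    qed
  qed
  from this[OF reach[OF i0(1)]] v0 have "m = 0" by simp
  then show ?thesis using le[OF \<open>i < n\<close>] by simp
qed

text \<open>A vector in the kernel of the minor, extended by 0, is harmonic away from 0.\<close>
lemma stochastic_minor_nonsingular:
  fixes p :: "nat \<Rightarrow> nat \<Rightarrow> real"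
  assumes "0 < n"
    and nonneg: "\<And>i j. i < n \<Longrightarrow> j < n \<Longrightarrow> 0 \<le> p i j"
    and stochastic: "\<And>i. i < n \<Longrightarrow> (\<Sum>j<n. p i j) = 1"
    and reach: "\<And>i. i < n \<Longrightarrow> (i, 0) \<in> {(i, j). i < n \<and> j < n \<and> 0 < p i j}\<^sup>*"
  shows "det (mat_delete (1\<^sub>m n - mat n n (\<lambda>(i, j). complex_of_real (p i j))) 0 0) \<noteq> 0"
proof
  obtain N where n: "n = Suc N" using \<open>0 < n\<close> gr0_conv_Suc by blast
  define B where "B = mat_delete (1\<^sub>m n - mat n n (\<lambda>(i, j). complex_of_real (p i j))) 0 0"
  have B: "B \<in> carrier_mat N N" by (simp add: B_def n mat_delete_def)
  have B_entry: "B $$ (i, j) = (if i = j then 1 else 0) - of_real (p (Suc i) (Suc j))" if "i < N" "j < N" for i j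
    using that by (simp add: B_def n mat_delete_def)
  assume "det (mat_delete (1\<^sub>m n - mat n n (\<lambda>(i, j). complex_of_real (p i j))) 0 0) = 0"
  then have "det B = 0" by (simp add: B_def)
  then obtain w where w: "w \<in> carrier_vec N" "w \<noteq> 0\<^sub>v N" "B *\<^sub>v w = 0\<^sub>v N"
    using det_0_iff_vec_prod_zero[OF B] by blast
  define v where "v i = (case i of 0 \<Rightarrow> 0 | Suc i' \<Rightarrow> w $ i')" for i
  have "v i = 0" if "i < n" for i
  proof (rule stochastic_maximum_principle[where p = p and v = v, OF nonneg stochastic reach _ _ that])
    fix i assume "0 < i" "i < n"
    then obtain k where k: "i = Suc k" "k < N" by (metis Suc_less_eq gr0_conv_Suc n)
    have "0 = (B *\<^sub>v w) $ k" using w(3) k by simp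
    also have "\<dots> = (\<Sum>j<N. B $$ (k, j) * w $ j)"
      using B w(1) k by (simp add: scalar_prod_def atLeast0LessThan)
    also have "\<dots> = (\<Sum>j<N. (if k = j then w $ j else 0) - of_real (p (Suc k) (Suc j)) * w $ j)"
      using k by (intro sum.cong) (auto simp: B_entry left_diff_distrib)
    also have "\<dots> = w $ k - (\<Sum>j<N. of_real (p (Suc k) (Suc j)) * w $ j)"
      using k by (simp add: sum_subtractf)
    finally show "v i = (\<Sum>j<n. of_real (p i j) * v j)"
      unfolding n sum.lessThan_Suc_shift by (simp add: v_def k)
  qed (simp_all add: v_def)
  from this[of "Suc _"] have "w = 0\<^sub>v N"
    using w(1) by (intro eq_vecI) (auto simp: v_def n)
  then show False using w(2) by simp
qed

text \<open>The product of a singular matrix with its adjugate is 0 in either order, so the columns of the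
  adjugate are harmonic and its rows are left invariant. Both spaces have
  dimension one because the minor at \<open>(0, 0)\<close> is nonsingular, and its determinant, the corner
  entry of the adjugate, makes \<open>\<kappa>\<close> nonzero.\<close>
lemma adjugate_stochastic:
  fixes p :: "nat \<Rightarrow> nat \<Rightarrow> real" and c :: "nat \<Rightarrow> real"
  assumes "0 < n"
    and nonneg: "\<And>i j. i < n \<Longrightarrow> j < n \<Longrightarrow> 0 \<le> p i j"
    and stochastic: "\<And>i. i < n \<Longrightarrow> (\<Sum>j<n. p i j) = 1"
    and reach: "\<And>i. i < n \<Longrightarrow> (i, 0) \<in> {(i, j). i < n \<and> j < n \<and> 0 < p i j}\<^sup>*"
    and invariant: "\<And>j. j < n \<Longrightarrow> c j = (\<Sum>h<n. c h * p h j)"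
    and nonzero: "h < n" "c h \<noteq> 0"
  obtains \<kappa> where "\<kappa> \<noteq> 0" "\<And>i j. i < n \<Longrightarrow> j < n \<Longrightarrow>
     adj_mat (1\<^sub>m n - mat n n (\<lambda>(i, j). complex_of_real (p i j))) $$ (i, j) = \<kappa> * of_real (c j)"
proof -
  obtain N where n: "n = Suc N" using \<open>0 < n\<close> gr0_conv_Suc by blast
  define P where "P = mat n n (\<lambda>(i, j). complex_of_real (p i j))"
  define K where "K = 1\<^sub>m n - P"
  define A where "A = adj_mat K"
  define B where "B = mat_delete K 0 0"
  have P: "P \<in> carrier_mat n n" and K: "K \<in> carrier_mat n n"
    unfolding K_def by (simp_all add: P_def minus_carrier_mat)
  have A: "A \<in> carrier_mat n n" "K * A = det K \<cdot>\<^sub>m 1\<^sub>m n" "A * K = det K \<cdot>\<^sub>m 1\<^sub>m n"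
    unfolding A_def using adj_mat[OF K] by auto
  have B: "B \<in> carrier_mat N N" using K by (simp add: B_def n mat_delete_def)
  have detB: "det B \<noteq> 0"
    using stochastic_minor_nonsingular[OF assms(1-4)] by (simp add: B_def K_def P_def)
  have K_entry: "K $$ (i, j) = (if i = j then 1 else 0) - of_real (p i j)" if "i < n" "j < n" for i j
    using that by (simp add: K_def P_def)
  have "det K = 0"
  proof -
    have "vec n (\<lambda>_. 1) \<noteq> (0\<^sub>v n :: complex vec)"
    proof
      assume "vec n (\<lambda>_. 1) = (0\<^sub>v n :: complex vec)"
      then have "vec n (\<lambda>_. 1) $ 0 = (0\<^sub>v n :: complex vec) $ 0" by simp
      then show False using \<open>0 < n\<close> by simp
    qed
    moreover have "K *\<^sub>v vec n (\<lambda>_. 1) = 0\<^sub>v n"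
    proof (rule eq_vecI)
      fix i assume "i < dim_vec (0\<^sub>v n :: complex vec)"
      then have i: "i < n" by simp
      then have "(K *\<^sub>v vec n (\<lambda>_. 1)) $ i = (\<Sum>j<n. (if i = j then 1 else 0) - complex_of_real (p i j))"
        using K by (simp add: scalar_prod_def atLeast0LessThan K_entry)
      also have "\<dots> = 1 - complex_of_real (\<Sum>j<n. p i j)"
        using i by (simp add: sum_subtractf)
      finally show "(K *\<^sub>v vec n (\<lambda>_. 1)) $ i = 0\<^sub>v n $ i" using i by (simp add: stochastic del: of_real_sum)
    qed (use K in simp)
    ultimately show ?thesis using det_0_iff_vec_prod_zero[OF K] by (metis vec_carrier)
  qed
  then have zero: "(\<Sum>k<n. K $$ (i, k) * A $$ (k, j)) = 0" "(\<Sum>k<n. A $$ (i, k) * K $$ (k, j)) = 0" if "i < n" "j < n" for i j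
    using index_mult_mat_sum[OF K A(1) that] index_mult_mat_sum[OF A(1) K that] that by (simp_all add: A)
  have columns: "A $$ (i, j) = A $$ (0, j)" if "i < n" "j < n" for i j
  proof -
    have "A $$ (i, j) - A $$ (0, j) = 0"
    proof (rule stochastic_maximum_principle[where p = p and v = "\<lambda>i. A $$ (i, j) - A $$ (0, j)", OF nonneg stochastic reach _ _ \<open>i < n\<close>])
      fix i assume i: "i < n"
      have "0 = (\<Sum>k<n. K $$ (i, k) * A $$ (k, j))" using zero(1)[OF i \<open>j < n\<close>] by (rule sym)
      also have "\<dots> = (\<Sum>k<n. (if i = k then A $$ (k, j) else 0) - of_real (p i k) * A $$ (k, j))"
        using i by (intro sum.cong) (auto simp: K_entry left_diff_distrib)
      also have "\<dots> = A $$ (i, j) - (\<Sum>k<n. of_real (p i k) * A $$ (k, j))"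
        using i by (simp add: sum_subtractf)
      finally have "A $$ (i, j) = (\<Sum>k<n. of_real (p i k) * A $$ (k, j))" by simp
      moreover have "(\<Sum>k<n. of_real (p i k) * A $$ (0, j)) = A $$ (0, j)"
        using stochastic[OF i] by (simp flip: sum_distrib_right of_real_sum)
      ultimately show "A $$ (i, j) - A $$ (0, j) = (\<Sum>k<n. of_real (p i k) * (A $$ (k, j) - A $$ (0, j)))"
        by (simp add: right_diff_distrib sum_subtractf)
    qed simp_all
    then show ?thesis by simp
  qed
  have corner: "A $$ (0, 0) \<noteq> 0"
    using detB K \<open>0 < n\<close> by (simp add: A_def B_def adj_mat_def cofactor_def)
  \<comment> \<open>The left invariant combination of \<open>c\<close> and the first row whose entry at 0 vanishes.\<close>
  define y where "y j = of_real (c j) * A $$ (0, 0) - of_real (c 0) * A $$ (0, j)" for j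
  have y_kernel: "(\<Sum>k<n. y k * K $$ (k, j)) = 0" if "j < n" for j
  proof -
    have "(\<Sum>k<n. of_real (c k) * K $$ (k, j)) = (\<Sum>k<n. (if k = j then of_real (c k) else 0) - complex_of_real (c k * p k j))"
      using that by (intro sum.cong) (auto simp: K_entry right_diff_distrib)
    also have "\<dots> = of_real (c j) - complex_of_real (\<Sum>k<n. c k * p k j)"
      using that by (simp add: sum_subtractf)
    also have "\<dots> = 0" using invariant[OF that] by simp
    finally have c: "(\<Sum>k<n. of_real (c k) * K $$ (k, j)) = 0" .
    have "(\<Sum>k<n. y k * K $$ (k, j)) = A $$ (0, 0) * (\<Sum>k<n. of_real (c k) * K $$ (k, j))
        - of_real (c 0) * (\<Sum>k<n. A $$ (0, k) * K $$ (k, j))"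
      unfolding sum_distrib_left sum_subtractf[symmetric] y_def
      by (intro sum.cong) (simp_all add: algebra_simps)
    then show ?thesis using c zero(2)[OF \<open>0 < n\<close> that] by simp
  qed
  have "vec N (\<lambda>k. y (Suc k)) = 0\<^sub>v N"
  proof (rule ccontr)
    assume ne: "vec N (\<lambda>k. y (Suc k)) \<noteq> 0\<^sub>v N"
    have "transpose_mat B *\<^sub>v vec N (\<lambda>k. y (Suc k)) = 0\<^sub>v N"
    proof (rule eq_vecI)
      fix j assume "j < dim_vec (0\<^sub>v N :: complex vec)"
      then have j: "j < N" by simp
      have "0 = (\<Sum>k<n. y k * K $$ (k, Suc j))" using y_kernel j n by simp
      also have "\<dots> = (\<Sum>k<N. y (Suc k) * K $$ (Suc k, Suc j))"
        unfolding n sum.lessThan_Suc_shift by (simp add: y_def)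
      also have "\<dots> = (\<Sum>k<N. B $$ (k, j) * y (Suc k))"
        using K j by (intro sum.cong) (auto simp: B_def n mat_delete_def)
      also have "\<dots> = (transpose_mat B *\<^sub>v vec N (\<lambda>k. y (Suc k))) $ j"
        using B j by (simp add: scalar_prod_def atLeast0LessThan)
      finally show "(transpose_mat B *\<^sub>v vec N (\<lambda>k. y (Suc k))) $ j = 0\<^sub>v N $ j" using j by simp
    qed (use B in simp)
    then have "det (transpose_mat B) = 0"
      using det_0_iff_vec_prod_zero[of "transpose_mat B" N] B ne by (metis transpose_carrier_mat vec_carrier)
    then show False using detB det_transpose[OF B] by simp
  qed
  then have "y (Suc k) = 0" if "k < N" for k using that by (metis index_vec index_zero_vec(1))
  moreover have "y 0 = 0" by (simp add: y_def)
  ultimately have y: "of_real (c j) * A $$ (0, 0) = of_real (c 0) * A $$ (0, j)" if "j < n" for j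
    using that by (cases j) (auto simp: y_def n)
  have "c 0 \<noteq> 0" using y[OF nonzero(1)] nonzero(2) corner by auto
  show thesis
  proof (rule that[of "A $$ (0, 0) / of_real (c 0)"])
    show "A $$ (0, 0) / of_real (c 0) \<noteq> 0" using corner \<open>c 0 \<noteq> 0\<close> by simp
    fix i j assume "i < n" "j < n"
    then show "adj_mat (1\<^sub>m n - mat n n (\<lambda>(i, j). complex_of_real (p i j))) $$ (i, j) = A $$ (0, 0) / of_real (c 0) * of_real (c j)"
      using columns[of i j] y[of j] \<open>c 0 \<noteq> 0\<close> by (simp add: A_def K_def P_def field_simps)
  qed
qed

lemma graph_matrix_entry_at_nat:
  fixes \<sigma> :: "'d::finite scheme"
  assumes "\<And>\<alpha>. \<alpha> \<in># consts_of \<sigma> i j \<Longrightarrow> 0 < \<alpha>" "i < num \<sigma>" "j < num \<sigma>"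
  shows "graph_matrix \<sigma> (of_nat m) $$ (i, j) = complex_of_real (\<Sum>\<alpha>\<in>#consts_of \<sigma> i j. \<alpha> ^ m)"
proof -
  have powr: "complex_of_real \<alpha> powr of_nat m = complex_of_real (\<alpha> ^ m)" if "0 < \<alpha>" for \<alpha>
    using that by (simp add: powr_nat)
  have "(\<Sum>\<alpha>\<in>#A. complex_of_real \<alpha> powr of_nat m) = complex_of_real (\<Sum>\<alpha>\<in>#A. \<alpha> ^ m)"
    if "\<And>\<alpha>. \<alpha> \<in># A \<Longrightarrow> 0 < \<alpha>" for A :: "real multiset"
    using that by (induction A) (simp_all add: powr)
  then show ?thesis using assms by (simp add: graph_matrix_def)
qed

lemma graph_matrix_deriv_entry_at_nat:
  fixes \<sigma> :: "'d::finite scheme"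
  assumes "\<And>\<alpha>. \<alpha> \<in># consts_of \<sigma> i j \<Longrightarrow> 0 < \<alpha>" "i < num \<sigma>" "j < num \<sigma>"
  shows "graph_matrix_deriv \<sigma> (of_nat m) $$ (i, j) = complex_of_real (\<Sum>\<alpha>\<in>#consts_of \<sigma> i j. \<alpha> ^ m * ln \<alpha>)"
proof -
  have "((\<lambda>z. \<Sum>\<alpha>\<in>#A. complex_of_real \<alpha> powr z) has_field_derivative
      complex_of_real (\<Sum>\<alpha>\<in>#A. \<alpha> ^ m * ln \<alpha>)) (at (of_nat m))"
    if "\<And>\<alpha>. \<alpha> \<in># A \<Longrightarrow> 0 < \<alpha>" for A :: "real multiset"
    using that
  proof (induction A)
    case (add \<alpha> A)
    then have "0 < \<alpha>" by simp
    then have "((\<lambda>z. complex_of_real \<alpha> powr z) has_field_derivative complex_of_real (\<alpha> ^ m * ln \<alpha>)) (at (of_nat m))"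
      by (auto intro!: derivative_eq_intros simp: powr_nat' Ln_of_real)
    from DERIV_add[OF this add.IH] add.prems show ?case by simp
  qed simp
  from this[OF assms(1)] show ?thesis
    using assms(2,3) by (simp add: graph_matrix_deriv_def graph_matrix_def DERIV_imp_deriv)
qed

text \<open>The adjugate is \<open>\<kappa>\<close> times the matrix with all rows \<open>c\<close>, and by the normalization of \<open>c\<close> the
  denominator of \<open>Q\<close> is \<open>\<kappa> / d\<close>.\<close>
lemma Q_col_eq:
  fixes \<sigma> :: "'d::finite scheme" and c :: "nat \<Rightarrow> real"
  defines "p \<equiv> \<lambda>i j. \<Sum>\<alpha>\<in>#consts_of \<sigma> i j. \<alpha> ^ CARD('d)"
  assumes pos: "\<And>i j \<alpha>. i < num \<sigma> \<Longrightarrow> j < num \<sigma> \<Longrightarrow> \<alpha> \<in># consts_of \<sigma> i j \<Longrightarrow> 0 < \<alpha>"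
    and stochastic: "\<And>i. i < num \<sigma> \<Longrightarrow> (\<Sum>j<num \<sigma>. p i j) = 1"
    and reach: "\<And>i. i < num \<sigma> \<Longrightarrow> (i, 0) \<in> {(i, j). i < num \<sigma> \<and> j < num \<sigma> \<and> 0 < p i j}\<^sup>*"
    and invariant: "\<And>j. j < num \<sigma> \<Longrightarrow> c j = (\<Sum>h<num \<sigma>. c h * p h j)"
    and normalized: "(\<Sum>h<num \<sigma>. c h * (\<Sum>j<num \<sigma>. \<Sum>\<alpha>\<in>#consts_of \<sigma> h j. \<alpha> ^ CARD('d) * ln \<alpha>)) = - inverse (real CARD('d))"
    and "h < num \<sigma>"
  shows "Q_col \<sigma> h = real CARD('d) * c h"
proof -
  let ?n = "num \<sigma>" and ?d = "CARD('d)"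
  have n: "0 < ?n" using \<open>h < num \<sigma>\<close> by linarith
  have d: "real ?d \<noteq> 0" by simp
  have nonneg: "0 \<le> p i j" if "i < ?n" "j < ?n" for i j
  proof -
    have "0 \<le> (\<Sum>\<alpha>\<in>#A. \<alpha> ^ ?d)" if "\<And>\<alpha>. \<alpha> \<in># A \<Longrightarrow> 0 < \<alpha>" for A :: "real multiset"
      using that by (induction A) (auto simp: add_nonneg_nonneg less_imp_le)
    then show ?thesis unfolding p_def using pos that by blast
  qed
  obtain h0 where h0: "h0 < ?n" "c h0 \<noteq> 0"
  proof -
    have "\<exists>h<?n. c h \<noteq> 0"
    proof (rule ccontr)
      assume "\<not> ?thesis"
      then have "(\<Sum>h<?n. c h * (\<Sum>j<?n. \<Sum>\<alpha>\<in>#consts_of \<sigma> h j. \<alpha> ^ ?d * ln \<alpha>)) = 0" by (intro sum.neutral) auto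
      then show False using normalized by simp
    qed
    then show thesis using that by blast
  qed
  define G where "G = graph_matrix \<sigma> (of_nat ?d)"
  define D where "D = graph_matrix_deriv \<sigma> (of_nat ?d)"
  define A where "A = adj_mat (1\<^sub>m ?n - G)"
  have "G = mat ?n ?n (\<lambda>(i, j). complex_of_real (p i j))"
  proof (rule eq_matI)
    fix i j assume "i < dim_row (mat ?n ?n (\<lambda>(i, j). complex_of_real (p i j)))" "j < dim_col (mat ?n ?n (\<lambda>(i, j). complex_of_real (p i j)))"
    then have ij: "i < ?n" "j < ?n" by simp_all
    show "G $$ (i, j) = mat ?n ?n (\<lambda>(i, j). complex_of_real (p i j)) $$ (i, j)"
      unfolding G_def using graph_matrix_entry_at_nat[OF pos[OF ij] ij, of ?d] ij by (simp add: p_def)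
  qed (simp_all add: G_def graph_matrix_def)
  then obtain \<kappa> where \<kappa>: "\<kappa> \<noteq> 0" "\<And>i j. i < ?n \<Longrightarrow> j < ?n \<Longrightarrow> A $$ (i, j) = \<kappa> * of_real (c j)"
    using adjugate_stochastic[OF n nonneg stochastic reach invariant h0] unfolding A_def by metis
  have A: "A \<in> carrier_mat ?n ?n" 
    unfolding A_def by (intro adj_mat(1) minus_carrier_mat) (simp add: G_def graph_matrix_def)
  have D: "D \<in> carrier_mat ?n ?n" by (simp add: D_def graph_matrix_deriv_def)
  have "mat_trace (A * D) = (\<Sum>i<?n. (A * D) $$ (i, i))"
    using A D by (simp add: mat_trace_def diag_mat_def sum_list_distinct_conv_sum_set atLeast0LessThan)
  also have "\<dots> = (\<Sum>i<?n. \<Sum>k<?n. \<kappa> * of_real (c k) * D $$ (k, i))"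
    by (intro sum.cong refl) (simp add: index_mult_mat_sum[OF A D] \<kappa>(2))
  also have "\<dots> = (\<Sum>k<?n. \<Sum>i<?n. \<kappa> * of_real (c k) * of_real (\<Sum>\<alpha>\<in>#consts_of \<sigma> k i. \<alpha> ^ ?d * ln \<alpha>))"
  proof (subst sum.swap, intro sum.cong refl)
    fix k i assume "k \<in> {..<?n}" "i \<in> {..<?n}"
    then have ki: "k < ?n" "i < ?n" by simp_all
    show "\<kappa> * of_real (c k) * D $$ (k, i) = \<kappa> * of_real (c k) * of_real (\<Sum>\<alpha>\<in>#consts_of \<sigma> k i. \<alpha> ^ ?d * ln \<alpha>)"
      unfolding D_def using graph_matrix_deriv_entry_at_nat[OF pos[OF ki] ki] by simp
  qed
  also have "\<dots> = \<kappa> * of_real (\<Sum>h<?n. c h * (\<Sum>j<?n. \<Sum>\<alpha>\<in>#consts_of \<sigma> h j. \<alpha> ^ ?d * ln \<alpha>))"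
    by (simp only: of_real_sum of_real_mult sum_distrib_left mult.assoc)
  also have "\<dots> = - (\<kappa> / of_nat ?d)"
    unfolding normalized by (simp add: divide_inverse)
  finally have trace: "- mat_trace (A * D) = \<kappa> / of_nat ?d" by simp
  have Q: "Q_matrix \<sigma> $$ (i, h) = complex_of_real (real ?d * c h)" if "i < ?n" for i
  proof -
    have "Q_matrix \<sigma> = inverse (- mat_trace (A * D)) \<cdot>\<^sub>m A"
      by (simp add: Q_matrix_def Let_def A_def D_def G_def)
    then have "Q_matrix \<sigma> $$ (i, h) = inverse (\<kappa> / of_nat ?d) * A $$ (i, h)"
      unfolding trace using A that \<open>h < ?n\<close> by simp
    also have "\<dots> = of_nat ?d * of_real (c h)"
      using \<kappa>(1) by (simp add: \<kappa>(2)[OF that \<open>h < ?n\<close>])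
    finally show ?thesis by simp
  qed
  show ?thesis unfolding Q_col_def
  proof (rule the_equality)
    show "\<forall>i<?n. Q_matrix \<sigma> $$ (i, h) = complex_of_real (real ?d * c h)" using Q by blast
    fix r assume "\<forall>i<?n. Q_matrix \<sigma> $$ (i, h) = complex_of_real r"
    then show "r = real ?d * c h" using Q[OF n] n by (metis of_real_eq_iff)
  qed
qed

section \<open>Tiles\<close>

lemma place_place: "place v \<alpha> (place w \<beta> S) = place (v + \<alpha> *\<^sub>R w) (\<alpha> * \<beta>) S"
  by (simp add: place_def image_image algebra_simps)

lemma place_0_1 [simp]: "place 0 1 S = S"
  by (simp add: place_def)

lemma place_inverse: "0 < \<alpha> \<Longrightarrow> place (- inverse \<alpha> *\<^sub>R v) (inverse \<alpha>) (place v \<alpha> S) = S"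
  by (simp add: place_place)

lemma place_mono: "S \<subseteq> S' \<Longrightarrow> place v \<alpha> S \<subseteq> place v \<alpha> S'"
  by (auto simp: place_def)

lemma inj_place: "0 < \<alpha> \<Longrightarrow> inj (place v \<alpha>)"
  by (rule inj_on_inverseI) (rule place_inverse)

lemma vol_place: "0 < \<alpha> \<Longrightarrow> vol (place v \<alpha> S) = \<alpha> ^ CARD('d) * vol S" for S :: "(real ^ 'd::finite) set"
  using measure_lebesgue_affine[of \<alpha> v S] by (simp add: place_def add.commute)

lemma interior_place:
  assumes "0 < \<alpha>" shows "interior (place v \<alpha> S) = place v \<alpha> (interior S)"
proof -
  have place: "place v \<alpha> S = (\<lambda>x. v + x) ` ((\<lambda>x. \<alpha> *\<^sub>R x) ` S)" for S :: "(real ^ 'a) set"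
    by (simp add: place_def image_image)
  have "interior ((\<lambda>x. \<alpha> *\<^sub>R x) ` S) = (\<lambda>x. \<alpha> *\<^sub>R x) ` interior S"
    using assms by (intro interior_injective_linear_image) (auto simp: inj_on_def intro!: linear_scaleR)
  then show ?thesis by (simp add: place interior_translation)
qed

text \<open>Otherwise the tile would be contained in its boundary, a null set.\<close>
lemma tile_interior_nonempty:
  assumes "tile T" shows "interior T \<noteq> {}"
proof
  assume "interior T = {}"
  then have "T \<subseteq> frontier T" using closure_subset by (auto simp: frontier_def)
  moreover have "frontier T \<in> null_sets lebesgue" using assms by (simp add: tile_def)
  ultimately have "T \<in> null_sets lebesgue" using negligible_iff_null_sets negligible_subset by blast
  then show False using assms by (simp add: tile_def measure_eq_0_null_sets)
qed

text \<open>A nontrivial translation that fixes a bounded set could be iterated to leave it.\<close>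
lemma translation_unique:
  fixes T :: "(real ^ 'd::finite) set"
  assumes "bounded T" "T \<noteq> {}" "0 < \<alpha>" "place v \<alpha> T = place w \<alpha> T"
  shows "v = w"
proof -
  define u where "u = inverse \<alpha> *\<^sub>R (v - w)"
  have "place u 1 T = T"
  proof -
    have "T = place (- inverse \<alpha> *\<^sub>R w) (inverse \<alpha>) (place v \<alpha> T)"
      using assms place_inverse[of \<alpha> w T] by simp
    also have "\<dots> = place u 1 T"
      using \<open>0 < \<alpha>\<close> by (simp add: place_place u_def algebra_simps)
    finally show ?thesis by simp
  qed
  then have step: "u + x \<in> T" if "x \<in> T" for x
    using that by (auto simp: place_def)
  obtain x where "x \<in> T" using assms by blast
  have iter: "real m *\<^sub>R u + x \<in> T" for m
  proof (induction m)
    case 0 then show ?case using \<open>x \<in> T\<close> by simp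
  next
    case (Suc m) from step[OF this] show ?case by (simp add: algebra_simps)
  qed
  obtain B where B: "\<And>y. y \<in> T \<Longrightarrow> norm y \<le> B"
    using \<open>bounded T\<close> by (auto simp: bounded_iff)
  have "real m * norm u \<le> 2 * B" for m
  proof -
    have "real m * norm u = norm ((real m *\<^sub>R u + x) - x)" by simp
    also have "\<dots> \<le> norm (real m *\<^sub>R u + x) + norm x" by (rule norm_triangle_ineq4)
    also have "\<dots> \<le> 2 * B" using B[OF iter[of m]] B[OF \<open>x \<in> T\<close>] by simp
    finally show ?thesis .
  qed
  then have "norm u = 0"
    using reals_Archimedean3[of "norm u"] by (metis norm_ge_zero less_le not_less)
  then show ?thesis using \<open>0 < \<alpha>\<close> by (simp add: u_def)
qed

locale normalized_scheme =
  fixes \<sigma> :: "'d::finite scheme"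
  assumes scheme: "substitution_scheme \<sigma>"
    and normalized: "normalized \<sigma>"
    and different: "geometrically_different \<sigma>"
begin

lemma tile_proto: "i < num \<sigma> \<Longrightarrow> tile (proto \<sigma> i)"
  and finite_rule: "i < num \<sigma> \<Longrightarrow> finite (rule \<sigma> i)"
  and tessellation_rule: "i < num \<sigma> \<Longrightarrow> tessellation (proto \<sigma> i) (rule \<sigma> i)"
  and vol_proto: "i < num \<sigma> \<Longrightarrow> vol (proto \<sigma> i) = 1"
  using scheme normalized by (auto simp: substitution_scheme_def normalized_def)

text \<open>The volume determines the scale, geometric difference the type, and boundedness the position.\<close>
lemma placed_unique:
  assumes "i < num \<sigma>" "j < num \<sigma>" "0 < \<alpha>" "0 < \<beta>"
    and eq: "place v \<alpha> (proto \<sigma> i) = place w \<beta> (proto \<sigma> j)"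
  shows "i = j \<and> \<alpha> = \<beta> \<and> v = w"
proof -
  have "\<alpha> ^ CARD('d) = \<beta> ^ CARD('d)"
    using arg_cong[OF eq, of vol] unfolding vol_place[OF assms(3)] vol_place[OF assms(4)]
    by (simp add: vol_proto assms(1,2))
  then have "\<alpha> = \<beta>" using assms by (simp add: power_eq_iff_eq_base)
  have "i = j"
  proof (rule ccontr)
    assume "i \<noteq> j"
    have "proto \<sigma> i = place (- inverse \<alpha> *\<^sub>R v) (inverse \<alpha>) (place w \<beta> (proto \<sigma> j))"
      using place_inverse[OF \<open>0 < \<alpha>\<close>, of v "proto \<sigma> i"] eq by simp
    then have "tile_of \<sigma> j (inverse \<alpha> * \<beta>) (proto \<sigma> i)"
      using assms by (auto simp: tile_of_def place_place)
    then show False using different \<open>i \<noteq> j\<close> assms by (auto simp: geometrically_different_def)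
  qed
  moreover have "v = w"
    using translation_unique[of "proto \<sigma> i" \<alpha> v w] tile_proto[of i] tile_interior_nonempty[of "proto \<sigma> i"] interior_subset
      assms \<open>i = j\<close> \<open>\<alpha> = \<beta>\<close> by (auto simp: tile_def)
  ultimately show ?thesis using \<open>\<alpha> = \<beta>\<close> by simp
qed

lemma tile_of_placed_iff:
  assumes "i < num \<sigma>" "j < num \<sigma>" "0 < \<alpha>"
  shows "tile_of \<sigma> j \<beta> (place v \<alpha> (proto \<sigma> i)) \<longleftrightarrow> j = i \<and> \<beta> = \<alpha>"
  using placed_unique[OF assms(1,2,3)] assms by (auto simp: tile_of_def)

lemma placement_exists:
  assumes "i < num \<sigma>" "U \<in> rule \<sigma> i"
  shows "\<exists>p. case p of (j, \<alpha>, v) \<Rightarrow> j < num \<sigma> \<and> 0 < \<alpha> \<and> \<alpha> < 1 \<and> U = place v \<alpha> (proto \<sigma> j)"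
  using scheme assms unfolding substitution_scheme_def tile_of_def by fastforce

definition placement :: "(real ^ 'd) set \<Rightarrow> nat \<times> real \<times> (real ^ 'd)" where
  "placement U = (SOME p. case p of (j, \<alpha>, v) \<Rightarrow> j < num \<sigma> \<and> 0 < \<alpha> \<and> \<alpha> < 1 \<and> U = place v \<alpha> (proto \<sigma> j))"

definition type_of where "type_of U = fst (placement U)"
definition scale_of where "scale_of U = fst (snd (placement U))"
definition position_of where "position_of U = snd (snd (placement U))"

lemma placement:
  assumes "i < num \<sigma>" "U \<in> rule \<sigma> i"
  shows "type_of U < num \<sigma>" "0 < scale_of U" "scale_of U < 1"
    "place (position_of U) (scale_of U) (proto \<sigma> (type_of U)) = U"
proof -
  obtain j \<alpha> v where p: "placement U = (j, \<alpha>, v)" by (metis prod_cases3)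
  have "case placement U of (j, \<alpha>, v) \<Rightarrow> j < num \<sigma> \<and> 0 < \<alpha> \<and> \<alpha> < 1 \<and> U = place v \<alpha> (proto \<sigma> j)"
    unfolding placement_def by (rule someI_ex[OF placement_exists[OF assms]])
  then have U: "j < num \<sigma>" "0 < \<alpha>" "\<alpha> < 1" "place v \<alpha> (proto \<sigma> j) = U"
    unfolding p by auto
  show "type_of U < num \<sigma>" "0 < scale_of U" "scale_of U < 1"
    "place (position_of U) (scale_of U) (proto \<sigma> (type_of U)) = U"
    by (simp_all add: U p type_of_def scale_of_def position_of_def)
qed

lemma tile_of_rule_iff:
  assumes "i < num \<sigma>" "U \<in> rule \<sigma> i" "j < num \<sigma>"
  shows "tile_of \<sigma> j \<beta> U \<longleftrightarrow> j = type_of U \<and> \<beta> = scale_of U"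
  using tile_of_placed_iff[OF placement(1)[OF assms(1,2)] assms(3) placement(2)[OF assms(1,2)]]
    placement(4)[OF assms(1,2)] by metis

lemma consts_of_eq:
  assumes "i < num \<sigma>" "j < num \<sigma>"
  shows "consts_of \<sigma> i j = image_mset scale_of (mset_set {U \<in> rule \<sigma> i. type_of U = j})"
proof -
  have "{U \<in> rule \<sigma> i. \<exists>\<alpha>. tile_of \<sigma> j \<alpha> U} = {U \<in> rule \<sigma> i. type_of U = j}"
    using tile_of_rule_iff[OF assms(1) _ assms(2)] by auto
  moreover have "(THE \<alpha>. tile_of \<sigma> j \<alpha> U) = scale_of U" if "U \<in> rule \<sigma> i" "type_of U = j" for U
    using tile_of_rule_iff[OF assms(1) that(1) assms(2)] that(2) by auto
  ultimately show ?thesis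
    unfolding consts_of_def using finite_rule[OF assms(1)] by (auto intro!: image_mset_cong)
qed

lemma sum_rule:
  fixes \<phi> :: "nat \<Rightarrow> real \<Rightarrow> real"
  assumes "i < num \<sigma>"
  shows "(\<Sum>U\<in>rule \<sigma> i. \<phi> (type_of U) (scale_of U)) = (\<Sum>j<num \<sigma>. \<Sum>\<alpha>\<in>#consts_of \<sigma> i j. \<phi> j \<alpha>)"
proof -
  have "(\<Sum>\<alpha>\<in>#consts_of \<sigma> i j. \<phi> j \<alpha>) = (\<Sum>U\<in>{U \<in> rule \<sigma> i. type_of U = j}. \<phi> (type_of U) (scale_of U))" if "j < num \<sigma>" for j
  proof -
    have "(\<Sum>\<alpha>\<in>#consts_of \<sigma> i j. \<phi> j \<alpha>) = (\<Sum>U\<in>{U \<in> rule \<sigma> i. type_of U = j}. \<phi> j (scale_of U))"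
      by (simp add: consts_of_eq[OF assms that] sum_unfold_sum_mset multiset.map_comp comp_def)
    then show ?thesis by simp
  qed
  then have "(\<Sum>j<num \<sigma>. \<Sum>\<alpha>\<in>#consts_of \<sigma> i j. \<phi> j \<alpha>)
      = (\<Sum>j<num \<sigma>. \<Sum>U\<in>{U \<in> rule \<sigma> i. type_of U = j}. \<phi> (type_of U) (scale_of U))"
    by simp
  also have "\<dots> = (\<Sum>U\<in>rule \<sigma> i. \<phi> (type_of U) (scale_of U))"
    by (rule sum.group) (use assms finite_rule placement(1) in auto)
  finally show ?thesis by simp
qed

text \<open>Tiles with disjoint interiors meet only in their boundaries, which are null sets.\<close>
lemma sum_vol_rule:
  assumes "i < num \<sigma>"
  shows "(\<Sum>U\<in>rule \<sigma> i. scale_of U ^ CARD('d)) = 1"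
proof -
  have tile: "tile U" if "U \<in> rule \<sigma> i" for U
    using tessellation_rule[OF assms] that by (simp add: tessellation_def)
  have "vol (\<Union>(rule \<sigma> i)) = (\<Sum>U\<in>rule \<sigma> i. vol U)"
  proof (rule measure_negligible_finite_Union[OF finite_rule[OF assms]])
    fix U assume "U \<in> rule \<sigma> i"
    then have "bounded U" "U \<in> sets lebesgue" using tile by (auto simp: tile_def)
    then show "U \<in> lmeasurable" by (rule bounded_set_imp_lmeasurable)
  next
    show "pairwise (\<lambda>S T. negligible (S \<inter> T)) (rule \<sigma> i)"
    proof (rule pairwiseI)
      fix U U' assume U: "U \<in> rule \<sigma> i" "U' \<in> rule \<sigma> i" "U \<noteq> U'"
      then have "interior U \<inter> interior U' = {}"
        using tessellation_rule[OF assms] by (auto simp: tessellation_def pairwise_def)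
      then have "U \<inter> U' \<subseteq> frontier U \<union> frontier U'"
        using closure_subset[of U] closure_subset[of U'] by (auto simp: frontier_def)
      moreover have "negligible (frontier U \<union> frontier U')"
        using tile[OF U(1)] tile[OF U(2)] by (auto simp: tile_def negligible_iff_null_sets)
      ultimately show "negligible (U \<inter> U')" by (rule negligible_subset[rotated])
    qed
  qed
  moreover have "\<Union>(rule \<sigma> i) = proto \<sigma> i"
    using tessellation_rule[OF assms] by (simp add: tessellation_def)
  moreover have "vol U = scale_of U ^ CARD('d)" if "U \<in> rule \<sigma> i" for U
    using vol_place[of "scale_of U" "position_of U" "proto \<sigma> (type_of U)"] placement[OF assms that]
    by (simp add: vol_proto)
  ultimately show ?thesis using vol_proto[OF assms] by simp
qed

sublocale substitution_graph "num \<sigma>" "CARD('d)" "consts_of \<sigma>"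
proof
  fix i j \<alpha> assume "i < num \<sigma>" "j < num \<sigma>" "\<alpha> \<in># consts_of \<sigma> i j"
  then show "0 < \<alpha> \<and> \<alpha> < 1"
    using placement finite_rule by (auto simp: consts_of_eq)
next
  fix i assume "i < num \<sigma>"
  then show "(\<Sum>j<num \<sigma>. \<Sum>\<alpha>\<in>#consts_of \<sigma> i j. \<alpha> ^ CARD('d)) = 1"
    using sum_rule[of i "\<lambda>j \<alpha>. \<alpha> ^ CARD('d)"] sum_vol_rule[of i] by simp
qed simp

lemma scale_of_mem_consts:
  "i < num \<sigma> \<Longrightarrow> U \<in> rule \<sigma> i \<Longrightarrow> scale_of U \<in># consts_of \<sigma> i (type_of U)"
  using placement(1) finite_rule by (simp add: consts_of_eq)

lemma sum_rule_edge_sum: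
  "i < num \<sigma> \<Longrightarrow> (\<Sum>U\<in>rule \<sigma> i. \<phi> (type_of U) (scale_of U)) = edge_sum i \<phi>"
  by (simp add: sum_rule edge_sum_def)

section \<open>The substitution flow\<close>

lemma substitute_placed:
  assumes "i < num \<sigma>" "0 < \<alpha>"
  shows "substitute \<sigma> (place v \<alpha> (proto \<sigma> i)) = place v \<alpha> ` rule \<sigma> i"
  unfolding substitute_def using placed_unique[OF assms(1) _ assms(2)] assms by blast

text \<open>One inclusion for all translations suffices: apply it to the inverse translation.\<close>
lemma substitute_translate: "substitute \<sigma> (place w 1 S) = place w 1 ` substitute \<sigma> S"
proof -
  have sub: "place w 1 ` substitute \<sigma> S \<subseteq> substitute \<sigma> (place w 1 S)" for w S
  proof clarify
    fix X assume "X \<in> substitute \<sigma> S"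
    then obtain v \<alpha> j U where X: "X = place v \<alpha> U" "0 < \<alpha>" "j < num \<sigma>" "S = place v \<alpha> (proto \<sigma> j)" "U \<in> rule \<sigma> j"
      unfolding substitute_def by blast
    then have "place w 1 X = place (w + v) \<alpha> U" "place w 1 S = place (w + v) \<alpha> (proto \<sigma> j)"
      by (simp_all add: place_place)
    then show "place w 1 X \<in> substitute \<sigma> (place w 1 S)" unfolding substitute_def using X by blast
  qed
  have untranslate: "place w 1 (place (- w) 1 X) = X" "place (- w) 1 (place w 1 X) = X" for X :: "(real ^ 'd) set"
    by (simp_all add: place_place)
  show ?thesis
  proof (intro equalityI sub)
    show "substitute \<sigma> (place w 1 S) \<subseteq> place w 1 ` substitute \<sigma> S"
    proof
      fix X assume "X \<in> substitute \<sigma> (place w 1 S)"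
      then have "place (- w) 1 X \<in> substitute \<sigma> S" using sub[of "- w" "place w 1 S"] untranslate by auto
      then show "X \<in> place w 1 ` substitute \<sigma> S" using untranslate by (metis imageI)
    qed
  qed
qed

lemma step_UN: "step \<sigma> (\<Union>x\<in>A. P x) = (\<Union>x\<in>A. step \<sigma> (P x))"
  by (auto simp: step_def)

lemma step_translate: "step \<sigma> (place w 1 ` P) = place w 1 ` step \<sigma> P"
proof -
  have "{S \<in> place w 1 ` P. vol S \<le> 1} = place w 1 ` {S \<in> P. vol S \<le> 1}"
    "{S \<in> place w 1 ` P. 1 < vol S} = place w 1 ` {S \<in> P. 1 < vol S}"
    by (auto simp: vol_place)
  then show ?thesis
    unfolding step_def by (simp only: image_Un image_UN UN_simps(10) substitute_translate)
qed

lemma iterate_UN: "(step \<sigma> ^^ m) (\<Union>x\<in>A. P x) = (\<Union>x\<in>A. (step \<sigma> ^^ m) (P x))"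
  by (induction m) (simp_all add: step_UN)

lemma iterate_translate: "(step \<sigma> ^^ m) (place w 1 ` P) = place w 1 ` (step \<sigma> ^^ m) P"
  by (induction m) (simp_all add: step_translate)

text \<open>Such patches are fixed by the substitution step; the flow stops at the first of them.\<close>
definition small :: "(real ^ 'd) set set \<Rightarrow> bool" where
  "small P \<longleftrightarrow> (\<forall>S\<in>P. vol S \<le> 1)"

lemma iterate_small: "small P \<Longrightarrow> (step \<sigma> ^^ m) P = P"
  by (induction m) (auto simp: step_def small_def)

lemma iterate_beyond_small:
  assumes "small ((step \<sigma> ^^ m) P)" "m \<le> m'"
  shows "(step \<sigma> ^^ m') P = (step \<sigma> ^^ m) P"
proof -
  have "(step \<sigma> ^^ m') P = (step \<sigma> ^^ (m' - m)) ((step \<sigma> ^^ m) P)"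
    using assms(2) by (simp flip: funpow_add o_apply[of "step \<sigma> ^^ _" "step \<sigma> ^^ _"])
  then show ?thesis using iterate_small[OF assms(1)] by simp
qed

abbreviation inflated :: "real \<Rightarrow> nat \<Rightarrow> (real ^ 'd) set set" where
  "inflated t i \<equiv> {place 0 (exp t) (proto \<sigma> i)}"

lemma flow_eq_iterate:
  assumes "small ((step \<sigma> ^^ m) (inflated t i))"
  shows "flow \<sigma> t i = (step \<sigma> ^^ m) (inflated t i)"
proof -
  let ?P = "\<lambda>m. (step \<sigma> ^^ m) (inflated t i)"
  let ?m = "LEAST m. small (?P m)"
  have "small (?P ?m)" using assms by (rule LeastI)
  moreover have "?m \<le> m" using assms by (rule Least_le)
  ultimately have "?P m = ?P ?m" by (rule iterate_beyond_small)
  then show ?thesis by (simp add: flow_def Let_def small_def)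
qed

lemma vol_inflated: "i < num \<sigma> \<Longrightarrow> vol (place 0 (exp t) (proto \<sigma> i)) = exp (real CARD('d) * t)"
  by (simp add: vol_place vol_proto exp_of_nat_mult)

lemma small_inflated: "i < num \<sigma> \<Longrightarrow> t \<le> 0 \<Longrightarrow> small (inflated t i)"
  by (simp add: small_def vol_inflated mult_nonneg_nonpos)

lemma flow_nonpos: "i < num \<sigma> \<Longrightarrow> t \<le> 0 \<Longrightarrow> flow \<sigma> t i = inflated t i"
  using flow_eq_iterate[of 0 t i] small_inflated by simp

text \<open>Children of an inflated tile have a smaller time parameter, and nonpositive times need no
  substitution: this is the induction along the subdivision process.\<close>
lemma rule_induct:
  assumes base: "\<And>t i. i < num \<sigma> \<Longrightarrow> t \<le> 0 \<Longrightarrow> P t i"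
    and step: "\<And>t i. i < num \<sigma> \<Longrightarrow> 0 < t \<Longrightarrow> (\<And>U. U \<in> rule \<sigma> i \<Longrightarrow> P (t + ln (scale_of U)) (type_of U)) \<Longrightarrow> P t i"
    and "i < num \<sigma>"
  shows "P t i"
proof (cases "t \<le> 0")
  case False
  show ?thesis
  proof (rule forward_induct[of 0 0 "\<lambda>i t. P t i"])
    fix i t assume *: "i < num \<sigma>" "0 \<le> t"
      "\<And>j \<alpha>. j < num \<sigma> \<Longrightarrow> \<alpha> \<in># consts_of \<sigma> i j \<Longrightarrow> 0 \<le> t + ln \<alpha> \<Longrightarrow> P (t + ln \<alpha>) j"
    show "P t i"
    proof (cases "t = 0")
      case False
      show ?thesis
      proof (rule step[OF *(1)])
        fix U assume "U \<in> rule \<sigma> i"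
        with *(1) show "P (t + ln (scale_of U)) (type_of U)"
          using *(3)[OF placement(1) scale_of_mem_consts] base[OF placement(1)] by (metis linear)
      qed (use False * in simp)
    qed (use base * in simp)
  qed (use False assms in auto)
qed (use base assms in simp)

lemma place_inflated:
  assumes "i < num \<sigma>" "U \<in> rule \<sigma> i"
  shows "place 0 (exp t) U = place (exp t *\<^sub>R position_of U) 1 (place 0 (exp (t + ln (scale_of U))) (proto \<sigma> (type_of U)))"
proof -
  have "place 0 (exp t) U = place 0 (exp t) (place (position_of U) (scale_of U) (proto \<sigma> (type_of U)))"
    using placement(4)[OF assms] by simp
  then show ?thesis
    using placement(2)[OF assms] by (simp add: place_place exp_add)
qed

lemma step_inflated:
  assumes "i < num \<sigma>" "0 < t"
  shows "step \<sigma> (inflated t i) = (\<Union>U\<in>rule \<sigma> i. place (exp t *\<^sub>R position_of U) 1 ` inflated (t + ln (scale_of U)) (type_of U))"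
proof -
  have "1 < vol (place 0 (exp t) (proto \<sigma> i))"
    using assms by (simp add: vol_inflated)
  then have "step \<sigma> (inflated t i) = place 0 (exp t) ` rule \<sigma> i"
    by (auto simp: step_def substitute_placed[OF assms(1)])
  also have "\<dots> = (\<Union>U\<in>rule \<sigma> i. place (exp t *\<^sub>R position_of U) 1 ` inflated (t + ln (scale_of U)) (type_of U))"
    by (auto simp: place_inflated[OF assms(1)])
  finally show ?thesis .
qed

lemma iterate_Suc_inflated:
  assumes "i < num \<sigma>" "0 < t"
  shows "(step \<sigma> ^^ Suc m) (inflated t i) = (\<Union>U\<in>rule \<sigma> i. place (exp t *\<^sub>R position_of U) 1 `
     (step \<sigma> ^^ m) (inflated (t + ln (scale_of U)) (type_of U)))"
  unfolding funpow_Suc_right o_apply step_inflated[OF assms] iterate_UN iterate_translate ..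

lemma flow_terminates:
  assumes "i < num \<sigma>" shows "\<exists>m. small ((step \<sigma> ^^ m) (inflated t i))"
proof (rule rule_induct[where P = "\<lambda>t i. \<exists>m. small ((step \<sigma> ^^ m) (inflated t i))", OF _ _ assms])
  fix t :: real and i assume "i < num \<sigma>" "t \<le> 0"
  then have "small ((step \<sigma> ^^ 0) (inflated t i))" using small_inflated by simp
  then show "\<exists>m. small ((step \<sigma> ^^ m) (inflated t i))" by blast
next
  fix t :: real and i assume *: "i < num \<sigma>" "0 < t"
    and "\<And>U. U \<in> rule \<sigma> i \<Longrightarrow> \<exists>m. small ((step \<sigma> ^^ m) (inflated (t + ln (scale_of U)) (type_of U)))"
  then obtain m where m: "\<And>U. U \<in> rule \<sigma> i \<Longrightarrow> small ((step \<sigma> ^^ m U) (inflated (t + ln (scale_of U)) (type_of U)))"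
    by metis
  define M where "M = Max (insert 0 (m ` rule \<sigma> i))"
  have le: "m U \<le> M" if "U \<in> rule \<sigma> i" for U
    unfolding M_def using finite_rule[OF *(1)] that by (intro Max_ge) auto
  have parts: "small ((step \<sigma> ^^ M) (inflated (t + ln (scale_of U)) (type_of U)))" if "U \<in> rule \<sigma> i" for U
  proof -
    show ?thesis
      unfolding iterate_beyond_small[OF m[OF that] le[OF that]] by (rule m[OF that])
  qed
  have "small ((step \<sigma> ^^ Suc M) (inflated t i))"
    unfolding iterate_Suc_inflated[OF *] using parts by (auto simp: small_def vol_place)
  then show "\<exists>m. small ((step \<sigma> ^^ m) (inflated t i))" by blast
qed

text \<open>Subdividing the children for a common, sufficiently large number of steps reaches all their
  flows at once.\<close>
lemma flow_rec:
  assumes "i < num \<sigma>" "0 < t"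
  shows "flow \<sigma> t i = (\<Union>U\<in>rule \<sigma> i. place (exp t *\<^sub>R position_of U) 1 ` flow \<sigma> (t + ln (scale_of U)) (type_of U))"
proof -
  have "\<forall>U\<in>rule \<sigma> i. \<exists>m. small ((step \<sigma> ^^ m) (inflated (t + ln (scale_of U)) (type_of U)))"
    using flow_terminates placement(1)[OF assms(1)] by blast
  then obtain m where m: "\<And>U. U \<in> rule \<sigma> i \<Longrightarrow> small ((step \<sigma> ^^ m U) (inflated (t + ln (scale_of U)) (type_of U)))"
    by metis
  obtain m0 where m0: "small ((step \<sigma> ^^ m0) (inflated t i))" using flow_terminates[OF assms(1)] by blast
  define M where "M = Max (insert m0 (m ` rule \<sigma> i))"
  have le: "m U \<le> M" if "U \<in> rule \<sigma> i" for U
    unfolding M_def using finite_rule[OF assms(1)] that by (intro Max_ge) auto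
  have parts: "(step \<sigma> ^^ M) (inflated (t + ln (scale_of U)) (type_of U)) = flow \<sigma> (t + ln (scale_of U)) (type_of U)" if "U \<in> rule \<sigma> i" for U
    using iterate_beyond_small[OF m[OF that] le[OF that]] flow_eq_iterate[OF m[OF that]] by simp
  have "m0 \<le> M" unfolding M_def using finite_rule[OF assms(1)] by (intro Max_ge) auto
  then have "flow \<sigma> t i = (step \<sigma> ^^ Suc M) (inflated t i)"
    using iterate_beyond_small[OF m0, of "Suc M"] flow_eq_iterate[OF m0] by simp
  then show ?thesis unfolding iterate_Suc_inflated[OF assms] by (simp add: parts)
qed

lemma flow_finite:
  assumes "i < num \<sigma>" shows "finite (flow \<sigma> t i)"
proof (rule rule_induct[where P = "\<lambda>t i. finite (flow \<sigma> t i)", OF _ _ assms])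
  fix t :: real and i assume *: "i < num \<sigma>" "0 < t" and "\<And>U. U \<in> rule \<sigma> i \<Longrightarrow> finite (flow \<sigma> (t + ln (scale_of U)) (type_of U))"
  then show "finite (flow \<sigma> t i)" unfolding flow_rec[OF *] using finite_rule by auto
qed (simp_all add: flow_nonpos)

text \<open>The length of the walk that leads to a tile can be read off from its scale.\<close>
lemma flow_tile_walk:
  assumes "i < num \<sigma>"
  shows "\<forall>S\<in>flow \<sigma> t i. \<exists>j v \<beta>. j < num \<sigma> \<and> 0 < \<beta> \<and> S = place v \<beta> (proto \<sigma> j) \<and> walk i j (t - ln \<beta>)"
proof (rule rule_induct[where P = "\<lambda>t i. \<forall>S\<in>flow \<sigma> t i. \<exists>j v \<beta>. j < num \<sigma> \<and> 0 < \<beta> \<and> S = place v \<beta> (proto \<sigma> j) \<and> walk i j (t - ln \<beta>)", OF _ _ assms])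
  fix t :: real and i assume *: "i < num \<sigma>" "t \<le> 0"
  have "i < num \<sigma> \<and> 0 < exp t \<and> place 0 (exp t) (proto \<sigma> i) = place 0 (exp t) (proto \<sigma> i) \<and> walk i i (t - ln (exp t))"
    using * walk_refl by simp
  then show "\<forall>S\<in>flow \<sigma> t i. \<exists>j v \<beta>. j < num \<sigma> \<and> 0 < \<beta> \<and> S = place v \<beta> (proto \<sigma> j) \<and> walk i j (t - ln \<beta>)"
    unfolding flow_nonpos[OF *] by blast
next
  fix t :: real and i assume *: "i < num \<sigma>" "0 < t" and IH: "\<And>U. U \<in> rule \<sigma> i \<Longrightarrow>
    \<forall>S\<in>flow \<sigma> (t + ln (scale_of U)) (type_of U). \<exists>j v \<beta>. j < num \<sigma> \<and> 0 < \<beta> \<and> S = place v \<beta> (proto \<sigma> j) \<and>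
       walk (type_of U) j (t + ln (scale_of U) - ln \<beta>)"
  show "\<forall>S\<in>flow \<sigma> t i. \<exists>j v \<beta>. j < num \<sigma> \<and> 0 < \<beta> \<and> S = place v \<beta> (proto \<sigma> j) \<and> walk i j (t - ln \<beta>)"
  proof
    fix S assume "S \<in> flow \<sigma> t i"
    then obtain U S' where U: "U \<in> rule \<sigma> i" "S = place (exp t *\<^sub>R position_of U) 1 S'"
      "S' \<in> flow \<sigma> (t + ln (scale_of U)) (type_of U)"
      unfolding flow_rec[OF *] by blast
    then obtain j v \<beta> where j: "j < num \<sigma>" "0 < \<beta>" "S' = place v \<beta> (proto \<sigma> j)" "walk (type_of U) j (t + ln (scale_of U) - ln \<beta>)"
      using IH by blast
    have "walk i j (t - ln \<beta>)"
      using walk_edge[OF *(1) placement(1)[OF *(1) U(1)] scale_of_mem_consts[OF *(1) U(1)] j(4)] by simp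
    then show "\<exists>j v \<beta>. j < num \<sigma> \<and> 0 < \<beta> \<and> S = place v \<beta> (proto \<sigma> j) \<and> walk i j (t - ln \<beta>)"
      using j U by (auto simp: place_place)
  qed
qed

lemma flow_subset:
  assumes "i < num \<sigma>" shows "\<forall>S\<in>flow \<sigma> t i. S \<subseteq> place 0 (exp t) (proto \<sigma> i)"
proof (rule rule_induct[where P = "\<lambda>t i. \<forall>S\<in>flow \<sigma> t i. S \<subseteq> place 0 (exp t) (proto \<sigma> i)", OF _ _ assms])
  fix t :: real and i assume *: "i < num \<sigma>" "0 < t" and IH: "\<And>U. U \<in> rule \<sigma> i \<Longrightarrow>
    \<forall>S\<in>flow \<sigma> (t + ln (scale_of U)) (type_of U). S \<subseteq> place 0 (exp (t + ln (scale_of U))) (proto \<sigma> (type_of U))"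
  show "\<forall>S\<in>flow \<sigma> t i. S \<subseteq> place 0 (exp t) (proto \<sigma> i)"
  proof
    fix S assume "S \<in> flow \<sigma> t i"
    then obtain U S' where U: "U \<in> rule \<sigma> i" "S = place (exp t *\<^sub>R position_of U) 1 S'"
      "S' \<in> flow \<sigma> (t + ln (scale_of U)) (type_of U)"
      unfolding flow_rec[OF *] by blast
    then have "S \<subseteq> place 0 (exp t) U"
      unfolding place_inflated[OF *(1) U(1)] using IH by (auto intro!: place_mono)
    also have "\<dots> \<subseteq> place 0 (exp t) (proto \<sigma> i)"
      using tessellation_rule[OF *(1)] U(1) by (intro place_mono) (auto simp: tessellation_def)
    finally show "S \<subseteq> place 0 (exp t) (proto \<sigma> i)" .
  qed
qed (simp_all add: flow_nonpos)

text \<open>A tile lies inside the child from which it was cut and has nonempty interior, so distinct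
  children contribute distinct tiles.\<close>
lemma card_flow_rec:
  assumes i: "i < num \<sigma>" "0 < t" and Q: "\<And>w S. Q (place w 1 S) \<longleftrightarrow> Q S"
  shows "card {S \<in> flow \<sigma> t i. Q S} = (\<Sum>U\<in>rule \<sigma> i. card {S \<in> flow \<sigma> (t + ln (scale_of U)) (type_of U). Q S})"
proof -
  define part where "part U = place (exp t *\<^sub>R position_of U) 1 ` {S \<in> flow \<sigma> (t + ln (scale_of U)) (type_of U). Q S}" for U
  have part: "S \<subseteq> place 0 (exp t) U" "interior S \<noteq> {}" if "U \<in> rule \<sigma> i" "S \<in> part U" for U S
  proof -
    note j = placement(1)[OF i(1) that(1)]
    obtain S' where S': "S = place (exp t *\<^sub>R position_of U) 1 S'" "S' \<in> flow \<sigma> (t + ln (scale_of U)) (type_of U)"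
      using \<open>S \<in> part U\<close> unfolding part_def by blast
    then show "S \<subseteq> place 0 (exp t) U"
      unfolding place_inflated[OF i(1) that(1)] using flow_subset[OF j] by (auto intro!: place_mono)
    obtain k v \<beta> where "k < num \<sigma>" "0 < \<beta>" "S' = place v \<beta> (proto \<sigma> k)"
      using flow_tile_walk[OF j] S'(2) by blast
    then show "interior S \<noteq> {}"
      using tile_interior_nonempty[OF tile_proto[of k]] by (simp add: S'(1) interior_place) (simp add: place_def)
  qed
  have "{S \<in> flow \<sigma> t i. Q S} = (\<Union>U\<in>rule \<sigma> i. part U)"
    unfolding flow_rec[OF i] part_def using Q by auto
  also have "card \<dots> = (\<Sum>U\<in>rule \<sigma> i. card (part U))"
  proof (rule card_UN_disjoint)
    show "\<forall>U\<in>rule \<sigma> i. finite (part U)"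
      using flow_finite placement(1)[OF i(1)] by (auto simp: part_def)
    show "\<forall>U\<in>rule \<sigma> i. \<forall>U'\<in>rule \<sigma> i. U \<noteq> U' \<longrightarrow> part U \<inter> part U' = {}"
    proof (intro ballI impI)
      fix U U' assume U: "U \<in> rule \<sigma> i" "U' \<in> rule \<sigma> i" "U \<noteq> U'"
      then have disj: "interior U \<inter> interior U' = {}"
        using tessellation_rule[OF i(1)] by (auto simp: tessellation_def pairwise_def)
      show "part U \<inter> part U' = {}"
      proof (rule equals0I)
        fix S assume S: "S \<in> part U \<inter> part U'"
        then have "interior S \<subseteq> place 0 (exp t) (interior U) \<inter> place 0 (exp t) (interior U')"
          using interior_mono[OF part(1)[OF U(1)]] interior_mono[OF part(1)[OF U(2)]] by (auto simp: interior_place)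
        also have "\<dots> = place 0 (exp t) (interior U \<inter> interior U')"
          by (auto simp: place_def)
        finally show False using part(2)[OF U(1)] S disj by (auto simp: place_def)
      qed
    qed
  qed (rule finite_rule[OF i(1)])
  also have "\<dots> = (\<Sum>U\<in>rule \<sigma> i. card {S \<in> flow \<sigma> (t + ln (scale_of U)) (type_of U). Q S})"
    unfolding part_def by (intro sum.cong refl card_image inj_on_subset[OF inj_place subset_UNIV]) simp
  finally show ?thesis .
qed

definition tile_count :: "nat \<Rightarrow> real \<Rightarrow> real \<Rightarrow> nat \<Rightarrow> real \<Rightarrow> real" where
  "tile_count j a b i t = real (card {S \<in> flow \<sigma> t i. \<exists>\<alpha>\<in>{a..b}. tile_of \<sigma> j \<alpha> S})"

lemma tile_of_translate: "tile_of \<sigma> j \<alpha> (place w 1 S) \<longleftrightarrow> tile_of \<sigma> j \<alpha> S"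
proof -
  have "tile_of \<sigma> j \<alpha> (place w 1 S)" if "tile_of \<sigma> j \<alpha> S" for w S
    using that by (auto simp: tile_of_def place_place)
  from this[of S w] this[of "place w 1 S" "- w"] show ?thesis by (auto simp: place_place)
qed

lemma tile_count_rec:
  assumes "i < num \<sigma>" "0 < t"
  shows "tile_count j a b i t = edge_sum i (\<lambda>g \<alpha>. tile_count j a b g (t + ln \<alpha>))"
  using card_flow_rec[OF assms, of "\<lambda>S. \<exists>\<alpha>\<in>{a..b}. tile_of \<sigma> j \<alpha> S"]
    sum_rule_edge_sum[OF assms(1), of "\<lambda>g \<alpha>. tile_count j a b g (t + ln \<alpha>)"]
  by (simp add: tile_count_def tile_of_translate)

lemma tile_count_nonpos:
  assumes "i < num \<sigma>" "j < num \<sigma>" "t \<le> 0"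
  shows "tile_count j a b i t = (if i = j \<and> exp t \<in> {a..b} then 1 else 0)"
proof -
  have "{S \<in> flow \<sigma> t i. \<exists>\<alpha>\<in>{a..b}. tile_of \<sigma> j \<alpha> S} = (if i = j \<and> exp t \<in> {a..b} then inflated t i else {})"
    using assms by (auto simp: flow_nonpos tile_of_placed_iff)
  then show ?thesis by (simp add: tile_count_def)
qed

text \<open>Only tiles of scale larger than 1 count as positions of the renewal process. A child at
  nonpositive time is a tile that is left over; it is moved into the source. A child at
  positive time has scale larger than \<open>b\<close>, so it is not double counted.\<close>
lemma solves_tile_count:
  assumes "j < num \<sigma>" "b \<le> 1"
  shows "solves (\<lambda>i t. if 0 < t then \<Sum>\<alpha>\<in>#consts_of \<sigma> i j. if \<alpha> * exp t \<in> {a..b} then 1 else 0 else 0)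
     (\<lambda>i t. if 0 < t then tile_count j a b i t else 0)"
  unfolding solves_def
proof (intro allI impI conjI)
  fix i t assume i: "i < num \<sigma>"
  let ?F = "\<lambda>i t. if 0 < t then tile_count j a b i t else 0"
  let ?w = "\<Sum>\<alpha>\<in>#consts_of \<sigma> i j. if \<alpha> * exp t \<in> {a..b} then 1 else 0 :: real"
  show "?F i t = edge_sum i (\<lambda>g \<alpha>. ?F g (t + ln \<alpha>)) + (if 0 < t then ?w else 0)"
  proof (cases "0 < t")
    case True
    have "tile_count j a b i t = edge_sum i (\<lambda>g \<alpha>. tile_count j a b g (t + ln \<alpha>))"
      by (rule tile_count_rec[OF i True])
    also have "\<dots> = edge_sum i (\<lambda>g \<alpha>. ?F g (t + ln \<alpha>) + (if g = j \<and> \<alpha> * exp t \<in> {a..b} then 1 else 0))"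
    proof (rule edge_sum_cong)
      fix g \<alpha> assume g: "g < num \<sigma>" "\<alpha> \<in># consts_of \<sigma> i g"
      have e: "exp (t + ln \<alpha>) = \<alpha> * exp t" using scale_pos[OF i g] by (simp add: exp_add)
      show "tile_count j a b g (t + ln \<alpha>) = ?F g (t + ln \<alpha>) + (if g = j \<and> \<alpha> * exp t \<in> {a..b} then 1 else 0)"
      proof (cases "0 < t + ln \<alpha>")
        case True
        then have "1 < \<alpha> * exp t" by (simp flip: e)
        then show ?thesis using True \<open>b \<le> 1\<close> by simp
      next
        case False
        then show ?thesis using tile_count_nonpos[OF g(1) assms(1), of "t + ln \<alpha>" a b] by (simp add: e)
      qed
    qed
    also have "\<dots> = edge_sum i (\<lambda>g \<alpha>. ?F g (t + ln \<alpha>)) + edge_sum i (\<lambda>g \<alpha>. if g = j \<and> \<alpha> * exp t \<in> {a..b} then 1 else 0)"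
      by (rule edge_sum_add)
    also have "edge_sum i (\<lambda>g \<alpha>. if g = j \<and> \<alpha> * exp t \<in> {a..b} then 1 else 0)
        = (\<Sum>g<num \<sigma>. if g = j then ?w else 0)"
      unfolding edge_sum_def by (intro sum.cong) auto
    also have "\<dots> = ?w" using assms(1) by simp
    finally show ?thesis using True by simp
  next
    case False
    have "edge_sum i (\<lambda>g \<alpha>. ?F g (t + ln \<alpha>)) = edge_sum i (\<lambda>g \<alpha>. 0)"
    proof (rule edge_sum_cong)
      fix g \<alpha> assume g: "g < num \<sigma>" "\<alpha> \<in># consts_of \<sigma> i g"
      then have "ln \<alpha> < 0" using scale_bounds[OF i g] by (simp add: ln_less_zero)
      then show "?F g (t + ln \<alpha>) = 0" using False by simp
    qed
    then show ?thesis using False by simp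
  qed
qed simp

lemma flow_tile_of_walk:
  assumes "i < num \<sigma>" "j < num \<sigma>" "S \<in> flow \<sigma> t i" "tile_of \<sigma> j \<alpha> S"
  shows "walk i j (t - ln \<alpha>)"
proof -
  obtain k v \<beta> where "k < num \<sigma>" "0 < \<beta>" "S = place v \<beta> (proto \<sigma> k)" "walk i k (t - ln \<beta>)"
    using flow_tile_walk[OF assms(1)] assms(3) by blast
  then show ?thesis using tile_of_placed_iff[of k j \<beta> \<alpha> v] assms by simp
qed

lemma unit_tile_walk:
  assumes "i < num \<sigma>" "S \<in> flow \<sigma> t i" "tile_of \<sigma> i \<alpha> S" "vol S = 1"
  shows "walk i i t"
proof -
  have "0 < \<alpha>" using assms(3) by (simp add: tile_of_def)
  moreover have "\<alpha> ^ CARD('d) = 1 ^ CARD('d)" using assms by (auto simp: tile_of_def vol_place vol_proto)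
  ultimately have "\<alpha> = 1" using power_eq_iff_eq_base[of "CARD('d)" \<alpha> 1] by simp
  then show ?thesis using flow_tile_of_walk[OF assms(1,1-3)] by simp
qed

end

section \<open>Asymptotic tile counts\<close>

context normalized_scheme
begin

lemma irreducible_walks:
  assumes "irreducible_scheme \<sigma>" "i < num \<sigma>" "j < num \<sigma>"
  shows "\<exists>l. walk i j l"
  using assms flow_tile_of_walk unfolding irreducible_scheme_def by metis

text \<open>Tiles of unit volume and of the original type stand for closed walks of length \<open>t\<^sub>1\<close> and \<open>t\<^sub>2\<close>.\<close>
lemma dense_walk_lengths_flow:
  assumes irreducible: "irreducible_scheme \<sigma>" and incommensurable: "incommensurable \<sigma>"
  shows dense_walk_lengths
proof -
  obtain p q t\<^sub>1 t\<^sub>2 S\<^sub>1 S\<^sub>2 \<alpha>\<^sub>1 \<alpha>\<^sub>2 where loops: "p < num \<sigma>" "q < num \<sigma>" "0 < t\<^sub>1" "0 < t\<^sub>2"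
      "S\<^sub>1 \<in> flow \<sigma> t\<^sub>1 p" "tile_of \<sigma> p \<alpha>\<^sub>1 S\<^sub>1" "vol S\<^sub>1 = 1"
      "S\<^sub>2 \<in> flow \<sigma> t\<^sub>2 q" "tile_of \<sigma> q \<alpha>\<^sub>2 S\<^sub>2" "vol S\<^sub>2 = 1"
    and irrational: "\<forall>r\<in>\<rat>. t\<^sub>1 \<noteq> r * t\<^sub>2"
    using incommensurable unfolding incommensurable_def by blast
  have "t\<^sub>1 / t\<^sub>2 \<notin> \<rat>" using irrational loops(4) by force
  with irreducible_walks[OF irreducible] unit_tile_walk[OF loops(1,5,6,7)] unit_tile_walk[OF loops(2,8,9,10)]
  show ?thesis
    using loops(1-4) by (intro dense_walk_lengths_if_incommensurable[of p q t\<^sub>1 t\<^sub>2])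
qed

lemma walk_reaches:
  assumes "walk i j l"
  shows "(i, j) \<in> {(i, j). i < num \<sigma> \<and> j < num \<sigma> \<and> 0 < (\<Sum>\<alpha>\<in>#consts_of \<sigma> i j. \<alpha> ^ CARD('d))}\<^sup>*"
  using assms
proof induction
  case (walk_edge i j \<alpha> k l)
  obtain B where B: "consts_of \<sigma> i j = add_mset \<alpha> B" using walk_edge.hyps(3) by (metis insert_DiffM)
  have "0 \<le> (\<Sum>\<beta>\<in>#B. \<beta> ^ CARD('d))"
    using scale_pos[OF walk_edge.hyps(1,2)] by (intro sum_mset_nonneg_real) (simp add: B less_imp_le)
  moreover have "0 < \<alpha> ^ CARD('d)" using scale_pos[OF walk_edge.hyps(1,2,3)] by simp
  ultimately have "0 < (\<Sum>\<alpha>\<in>#consts_of \<sigma> i j. \<alpha> ^ CARD('d))" by (simp add: B)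
  then show ?case using walk_edge by (intro converse_rtrancl_into_rtrancl[of i j]) auto
qed simp

text \<open>The tile count solves the renewal equation with the window source, whose limit is a
  combination of the limits \<open>c\<close> of the walk counts; and \<open>Q_col\<close> is \<open>d\<close> times \<open>c\<close>.\<close>
lemma tile_count_asymptotics:
  assumes irreducible: "irreducible_scheme \<sigma>" and incommensurable: "incommensurable \<sigma>"
    and ij: "i < num \<sigma>" "j < num \<sigma>" and ab: "a < b" "b \<le> 1"
  shows "((\<lambda>t. tile_count j a b i t * exp (- real CARD('d) * t)) \<longlongrightarrow> tile_density \<sigma> j a b) at_top"
proof -
  have n: "0 < num \<sigma>" using ij by linarith
  have "\<forall>h. \<exists>c. \<forall>i<num \<sigma>. ((\<lambda>t. walk_count h i t * exp (- real CARD('d) * t)) \<longlongrightarrow> c) at_top"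
    using walk_count_asymptotics[OF dense_walk_lengths_flow[OF irreducible incommensurable]] by blast
  then obtain c where c: "\<And>h i. i < num \<sigma> \<Longrightarrow> ((\<lambda>t. walk_count h i t * exp (- real CARD('d) * t)) \<longlongrightarrow> c h) at_top"
    by metis
  have Q: "Q_col \<sigma> h = real CARD('d) * c h" if "h < num \<sigma>" for h
  proof (rule Q_col_eq[OF scale_pos volume_preserved _ walk_limit_left_invariant[OF c] _ that])
    show "(i, 0) \<in> {(i, j). i < num \<sigma> \<and> j < num \<sigma> \<and> 0 < (\<Sum>\<alpha>\<in>#consts_of \<sigma> i j. \<alpha> ^ CARD('d))}\<^sup>*" if "i < num \<sigma>" for i
      using irreducible_walks[OF irreducible that n] walk_reaches by blast
    have "(\<Sum>h<num \<sigma>. c h * edge_sum h (\<lambda>j \<alpha>. - real CARD('d) * (\<alpha> ^ CARD('d) * ln \<alpha>))) = 1"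
      using walk_limit_normalized[OF c n] by (simp add: mult_ac)
    then have "- real CARD('d) * (\<Sum>h<num \<sigma>. c h * edge_sum h (\<lambda>j \<alpha>. \<alpha> ^ CARD('d) * ln \<alpha>)) = 1"
      unfolding edge_sum_cmult by (simp add: sum_distrib_left mult_ac)
    then show "(\<Sum>h<num \<sigma>. c h * (\<Sum>j<num \<sigma>. \<Sum>\<alpha>\<in>#consts_of \<sigma> h j. \<alpha> ^ CARD('d) * ln \<alpha>)) = - inverse (real CARD('d))"
      unfolding edge_sum_def by (simp add: field_simps)
  qed
  have "((\<lambda>t. (if 0 < t then tile_count j a b i t else 0) * exp (- real CARD('d) * t)) \<longlongrightarrow>
     (\<Sum>h<num \<sigma>. c h * (\<Sum>\<alpha>\<in>#consts_of \<sigma> h j. \<alpha> ^ CARD('d) *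
        (inverse (max a \<alpha> ^ CARD('d)) - inverse (max b \<alpha> ^ CARD('d)))))) at_top"
    using ab by (intro window_count_asymptotics[OF c solves_tile_count] ij) auto
  also have "(\<Sum>h<num \<sigma>. c h * (\<Sum>\<alpha>\<in>#consts_of \<sigma> h j. \<alpha> ^ CARD('d) *
        (inverse (max a \<alpha> ^ CARD('d)) - inverse (max b \<alpha> ^ CARD('d))))) = tile_density \<sigma> j a b"
    unfolding tile_density_def c_coeff_def power_int_minus power_int_of_nat
  proof (intro sum.cong refl)
    fix h assume "h \<in> {..<num \<sigma>}"
    then have h: "Q_col \<sigma> h = real CARD('d) * c h" using Q by simp
    have "c h * x = 1 / real CARD('d) * x * (real CARD('d) * c h)" for x by simp
    then show "c h * (\<Sum>\<alpha>\<in>#consts_of \<sigma> h j. \<alpha> ^ CARD('d) * (inverse (max a \<alpha> ^ CARD('d)) - inverse (max b \<alpha> ^ CARD('d))))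
        = 1 / real CARD('d) * (\<Sum>\<alpha>\<in>#consts_of \<sigma> h j. \<alpha> ^ CARD('d) * (inverse (max a \<alpha> ^ CARD('d)) - inverse (max b \<alpha> ^ CARD('d)))) * Q_col \<sigma> h"
      unfolding h .
  qed
  finally show ?thesis
    by (rule Lim_transform_eventually) (use eventually_gt_at_top[of 0] in \<open>eventually_elim, simp\<close>)
qed

end

theorem theorem7p3:
  fixes \<sigma> :: "'d::finite scheme" and i j :: nat and a b :: real
  assumes "substitution_scheme \<sigma>" and "normalized \<sigma>" and "geometrically_different \<sigma>"
    and "irreducible_scheme \<sigma>" and "incommensurable \<sigma>"
    and "i < num \<sigma>" and "j < num \<sigma>"
    and "0 \<le> a" and "a < b" and "b \<le> 1"
  shows "(\<lambda>t::real. real (card {S \<in> flow \<sigma> t i. \<exists>\<alpha>\<in>{a..b}. tile_of \<sigma> j \<alpha> S})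
            - tile_density \<sigma> j a b * exp (real CARD('d) * t))
         \<in> o[at_top](\<lambda>t. exp (real CARD('d) * t))"
proof -
  interpret normalized_scheme \<sigma>
    using assms(1-3) by unfold_locales
  have "((\<lambda>t. tile_count j a b i t * exp (- real CARD('d) * t) - tile_density \<sigma> j a b) \<longlongrightarrow> 0) at_top"
    using tile_count_asymptotics[OF assms(4-7,9,10)] by (rule LIM_zero)
  moreover have "tile_count j a b i t * exp (- real CARD('d) * t) - tile_density \<sigma> j a b
      = (tile_count j a b i t - tile_density \<sigma> j a b * exp (real CARD('d) * t)) / exp (real CARD('d) * t)" for t
    by (simp add: exp_minus field_simps)
  ultimately have "((\<lambda>t. (tile_count j a b i t - tile_density \<sigma> j a b * exp (real CARD('d) * t)) / exp (real CARD('d) * t)) \<longlongrightarrow> 0) at_top"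
    by (simp only:)
  then show ?thesis
    unfolding tile_count_def by (intro smalloI_tendsto) simp_all
qed

end
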